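(* For every fixed choice of a real number $\epsilon>0$ and an integer $r\ge 2$, there exists an algorithm $\mathcal{A}'(\epsilon,r)$ that takes as input an $r$-uniform bipartite hypergraph $H=(A,B,E)$, runs in polynomial time, and terminates after finding either (i) a perfect matching in $H$, or (ii) a set $S\subseteq A$ such that $\tau(E_S)\le (2r-3+\epsilon)(|S|-1)$.
   Context: An $r$-uniform bipartite hypergraph $H=(A,B,E)$ is a (finite) hypergraph whose vertex set is partitioned into two sets $A$ and $B$ such that every edge $e\in E$ satisfies $|e\cap A|=1$ and $|e\cap B|=r-1$. The bipartition $(A,B)$ is given to the algorithm as part of the input. A perfect matching in $H$ is a collection of pairwise disjoint edges such that every vertex of $A$ is contained in exactly one edge of the collection (vertices of $B$ need not be covered). For $S\subseteq A$, $E_S:=\{e\in E : |e\cap S|=1\}$ is the set of edges incident to $S$. For $F\subseteq E$, $\tau(F)$ is the smallest cardinality of a subset of $B$ that hits all edges of $F$, where $R\subseteq B$ hits $F$ if $R\cap e\ne\emptyset$ for every $e\in F$. The running time is polynomial in the size of the input for each fixed pair $(\epsilon,r)$; the polynomial may depend on $\epsilon$ and $r$. *)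

theory Defs
  imports "HOL-Computational_Algebra.Polynomial"
begin

section \<open>Model of computation\<close>

text \<open>
  Algorithms are programs of a deterministic first-order call-by-value language (pure Lisp) over
  binary trees. A program is a finite list of function bodies; \<open>Call f es\<close> invokes body number
  \<open>f\<close> in the environment consisting of the argument values, and \<open>Var i\<close> denotes entry \<open>i\<close> of the
  environment (de Bruijn index). Recursion is unrestricted.

  The semantics charges one time unit per evaluated expression node. With trees represented by
  pointers, every such step takes a constant number of pointer operations (the constant depends
  on the program only) and allocates at most one cell: \<open>ECons\<close> is the only data-creating
  operation, and there is no unit-cost comparison or arithmetic. Hence a run of \<open>n\<close> steps can be
  simulated by a Turing machine in time polynomial in \<open>n\<close> and the input size, and conversely this
  language simulates Turing machines with polynomial overhead, so that polynomial time here
  is polynomial time in the usual sense.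
\<close>

datatype tree = Leaf | Node tree tree

datatype exp =
    Var nat
  | ENil
  | ECons exp exp
  | EHd exp
  | ETl exp
  | EIf exp exp exp
  | ELet exp exp
  | Call nat "exp list"

type_synonym program = "exp list"

fun hd_tree :: "tree \<Rightarrow> tree" where
  "hd_tree Leaf = Leaf"
| "hd_tree (Node l r) = l"

fun tl_tree :: "tree \<Rightarrow> tree" where
  "tl_tree Leaf = Leaf"
| "tl_tree (Node l r) = r"

text \<open>
  \<open>eval p env e v n\<close>: in program \<open>p\<close> and environment \<open>env\<close>, expression \<open>e\<close> terminates with value
  \<open>v\<close> in exactly \<open>n\<close> time units. Diverging and ill-formed expressions (variable or function
  index out of range) have no value. \<open>Leaf\<close> is the only false value.
\<close>

inductive eval :: "program \<Rightarrow> tree list \<Rightarrow> exp \<Rightarrow> tree \<Rightarrow> nat \<Rightarrow> bool"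
  and evals :: "program \<Rightarrow> tree list \<Rightarrow> exp list \<Rightarrow> tree list \<Rightarrow> nat \<Rightarrow> bool"
  for p :: program where
  eval_Var: "i < length env \<Longrightarrow> eval p env (Var i) (env ! i) 1"
| eval_Nil: "eval p env ENil Leaf 1"
| eval_Cons: "eval p env a u m \<Longrightarrow> eval p env b v n \<Longrightarrow>
    eval p env (ECons a b) (Node u v) (m + n + 1)"
| eval_Hd: "eval p env a u m \<Longrightarrow> eval p env (EHd a) (hd_tree u) (m + 1)"
| eval_Tl: "eval p env a u m \<Longrightarrow> eval p env (ETl a) (tl_tree u) (m + 1)"
| eval_IfTrue: "eval p env c w k \<Longrightarrow> w \<noteq> Leaf \<Longrightarrow> eval p env a u m \<Longrightarrow>
    eval p env (EIf c a b) u (k + m + 1)"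
| eval_IfFalse: "eval p env c Leaf k \<Longrightarrow> eval p env b v n \<Longrightarrow>
    eval p env (EIf c a b) v (k + n + 1)"
| eval_Let: "eval p env a u m \<Longrightarrow> eval p (u # env) b v n \<Longrightarrow>
    eval p env (ELet a b) v (m + n + 1)"
| eval_Call: "evals p env es vs m \<Longrightarrow> f < length p \<Longrightarrow> eval p vs (p ! f) v n \<Longrightarrow>
    eval p env (Call f es) v (m + n + 1)"
| evals_Nil: "evals p env [] [] 0"
| evals_Cons: "eval p env e v m \<Longrightarrow> evals p env es vs n \<Longrightarrow>
    evals p env (e # es) (v # vs) (m + n)"

text \<open>The first function of a program is its entry point; it receives the input as its argument.\<close>

definition runs :: "program \<Rightarrow> tree \<Rightarrow> tree \<Rightarrow> nat \<Rightarrow> bool" where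
  "runs p input output n \<longleftrightarrow> 0 < length p \<and> eval p [input] (p ! 0) output n"

lemma eval_deterministic:
  "eval p env e v n \<Longrightarrow> eval p env e v' n' \<Longrightarrow> v = v' \<and> n = n'"
  "evals p env es vs m \<Longrightarrow> evals p env es vs' m' \<Longrightarrow> vs = vs' \<and> m = m'"
proof (induction arbitrary: v' n' and vs' m' rule: eval_evals.inducts)
  case (eval_Var i env)
  from eval_Var.prems show ?case by cases auto
next
  case (eval_Nil env)
  from eval_Nil.prems show ?case by cases auto
next
  case (eval_Cons env a u m b v n)
  from eval_Cons.prems show ?case by cases (use eval_Cons in blast)+
next
  case (eval_Hd env a u m)
  from eval_Hd.prems show ?case by cases (use eval_Hd in blast)+
next
  case (eval_Tl env a u m)
  from eval_Tl.prems show ?case by cases (use eval_Tl in blast)+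
next
  case (eval_IfTrue env c w k a u m b)
  from eval_IfTrue.prems show ?case by cases (use eval_IfTrue in blast)+
next
  case (eval_IfFalse env c k b v n a)
  from eval_IfFalse.prems show ?case by cases (use eval_IfFalse in blast)+
next
  case (eval_Let env a u m b v n)
  from eval_Let.prems show ?case by cases (use eval_Let in blast)+
next
  case (eval_Call env es vs m f v n)
  from eval_Call.prems show ?case by cases (use eval_Call in blast)+
next
  case (evals_Nil env)
  from evals_Nil.prems show ?case by cases auto
next
  case (evals_Cons env e v m es vs n)
  from evals_Cons.prems show ?case by cases (use evals_Cons in blast)+
qed

lemma runs_deterministic: "runs p t u n \<Longrightarrow> runs p t u' n' \<Longrightarrow> u = u' \<and> n = n'"
  unfolding runs_def using eval_deterministic(1) by blast


section \<open>Encoding of the data\<close>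

text \<open>
  Vertices are natural numbers, written in binary with the least significant bit first. Finite
  sets are written as lists without repetition in an arbitrary order, so a set has several
  encodings; an algorithm has to cope with all encodings of its input. The size of an input is
  the number of its inner nodes, which is linear in its length as a bit string.
\<close>

fun tree_of_list :: "tree list \<Rightarrow> tree" where
  "tree_of_list [] = Leaf"
| "tree_of_list (t # ts) = Node t (tree_of_list ts)"

fun tree_of_nat :: "nat \<Rightarrow> tree" where
  "tree_of_nat n = (if n = 0 then Leaf
     else Node (if even n then Leaf else Node Leaf Leaf) (tree_of_nat (n div 2)))"

declare tree_of_nat.simps [simp del]

definition encodes_vertex :: "nat \<Rightarrow> tree \<Rightarrow> bool" where
  "encodes_vertex x t \<longleftrightarrow> t = tree_of_nat x"

definition encodes_set :: "('a \<Rightarrow> tree \<Rightarrow> bool) \<Rightarrow> 'a set \<Rightarrow> tree \<Rightarrow> bool" where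
  "encodes_set enc X t \<longleftrightarrow>
     (\<exists>xs ts. distinct xs \<and> set xs = X \<and> list_all2 enc xs ts \<and> t = tree_of_list ts)"

abbreviation encodes_vertices :: "nat set \<Rightarrow> tree \<Rightarrow> bool" where
  "encodes_vertices \<equiv> encodes_set encodes_vertex"

abbreviation encodes_edges :: "nat set set \<Rightarrow> tree \<Rightarrow> bool" where
  "encodes_edges \<equiv> encodes_set encodes_vertices"

definition encodes_hypergraph ::
  "nat set \<Rightarrow> nat set \<Rightarrow> nat set set \<Rightarrow> tree \<Rightarrow> bool" where
  "encodes_hypergraph A B E t \<longleftrightarrow>
     (\<exists>a b e. encodes_vertices A a \<and> encodes_vertices B b \<and> encodes_edges E e \<and>
        t = Node a (Node b e))"

text \<open>
  The first component of an output distinguishes the two outcomes. As encodings are free of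
  repetitions, every output that describes a subset of the edges or vertices of the input has
  size polynomial in the input when written out without sharing.
\<close>

definition outputs_matching :: "tree \<Rightarrow> nat set set \<Rightarrow> bool" where
  "outputs_matching u M \<longleftrightarrow> (\<exists>t. encodes_edges M t \<and> u = Node Leaf t)"

definition outputs_vertex_set :: "tree \<Rightarrow> nat set \<Rightarrow> bool" where
  "outputs_vertex_set u S \<longleftrightarrow> (\<exists>t. encodes_vertices S t \<and> u = Node (Node Leaf Leaf) t)"

lemma tree_of_list_inj: "tree_of_list xs = tree_of_list ys \<Longrightarrow> xs = ys"
proof (induction xs arbitrary: ys)
  case Nil then show ?case by (cases ys) auto
next
  case (Cons x xs) then show ?case by (cases ys) auto
qed

lemma tree_of_nat_inj: "tree_of_nat m = tree_of_nat n \<Longrightarrow> m = n"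
proof (induction m arbitrary: n rule: less_induct)
  case (less m)
  show ?case
  proof (cases "m = 0 \<or> n = 0")
    case True
    then show ?thesis using less.prems
      by (auto simp: tree_of_nat.simps[of m] tree_of_nat.simps[of n] split: if_splits)
  next
    case False
    then have *: "even m = even n" "tree_of_nat (m div 2) = tree_of_nat (n div 2)"
      using less.prems
      by (auto simp: tree_of_nat.simps[of m] tree_of_nat.simps[of n] split: if_splits)
    have "m div 2 = n div 2" using less.IH[OF _ *(2)] False by simp
    with *(1) show ?thesis by (metis dvd_mult_div_cancel odd_two_times_div_two_succ)
  qed
qed

lemma encodes_set_unique:
  assumes "\<And>x y t. enc x t \<Longrightarrow> enc y t \<Longrightarrow> x = y"
    and "encodes_set enc X t" and "encodes_set enc Y t"
  shows "X = Y"
proof -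
  obtain xs ys ts where xs: "set xs = X" "list_all2 enc xs ts"
    and ys: "set ys = Y" "list_all2 enc ys ts"
    using assms(2,3) tree_of_list_inj unfolding encodes_set_def by blast
  have "xs = ys"
    using xs(2) ys(2) assms(1) by (auto simp: list_all2_conv_all_nth intro!: nth_equalityI)
  with xs ys show ?thesis by simp
qed

lemma encodes_vertices_unique: "encodes_vertices X t \<Longrightarrow> encodes_vertices Y t \<Longrightarrow> X = Y"
  by (rule encodes_set_unique[of encodes_vertex])
    (auto simp: encodes_vertex_def dest: tree_of_nat_inj)

lemma encodes_edges_unique: "encodes_edges X t \<Longrightarrow> encodes_edges Y t \<Longrightarrow> X = Y"
  by (rule encodes_set_unique[of encodes_vertices]) (auto dest: encodes_vertices_unique)


section \<open>Bipartite hypergraphs\<close>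

definition uniform_bipartite_hypergraph ::
  "nat \<Rightarrow> 'a set \<Rightarrow> 'a set \<Rightarrow> 'a set set \<Rightarrow> bool" where
  "uniform_bipartite_hypergraph r A B E \<longleftrightarrow>
     finite A \<and> finite B \<and> A \<inter> B = {} \<and>
     (\<forall>e\<in>E. e \<subseteq> A \<union> B \<and> card (e \<inter> A) = 1 \<and> card (e \<inter> B) = r - 1)"

definition perfect_matching :: "'a set \<Rightarrow> 'a set set \<Rightarrow> 'a set set \<Rightarrow> bool" where
  "perfect_matching A E M \<longleftrightarrow>
     M \<subseteq> E \<and> pairwise disjnt M \<and> (\<forall>a\<in>A. \<exists>!e. e \<in> M \<and> a \<in> e)"

definition edges_at :: "'a set set \<Rightarrow> 'a set \<Rightarrow> 'a set set" where
  "edges_at E S = {e \<in> E. card (e \<inter> S) = 1}"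

definition hits :: "'a set \<Rightarrow> 'a set set \<Rightarrow> bool" where
  "hits R F \<longleftrightarrow> (\<forall>e\<in>F. R \<inter> e \<noteq> {})"

definition tau :: "'a set \<Rightarrow> 'a set set \<Rightarrow> nat" where
  "tau B F = (LEAST k. \<exists>R. R \<subseteq> B \<and> finite R \<and> hits R F \<and> card R = k)"

end

theory Submission
  imports Defs
begin

text \<open>
  Grow alternating layers from an uncovered vertex \<open>v\<close> of \<open>A\<close>: a layer is a set of disjoint edges
  that leave the vertices reached so far and avoid everything used so far inside \<open>B\<close>, and the edges
  of the matching that block the layer supply the newly reached vertices. If a new layer is smaller
  than a fixed fraction \<open>1/D\<close> of the reached part, then the vertices of \<open>B\<close> in use hit all edges at
  the reached vertices, up to an error that \<open>\<epsilon>\<close> absorbs; a layer edge with its blocker costs \<open>2r - 3\<close>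
  vertices. Layers therefore grow geometrically and there are only logarithmically many.

  Whenever a fraction \<open>1/G\<close> of the blockers of some layer can be exchanged for edges that are
  disjoint from the matching inside \<open>B\<close>, this is done at once and all later layers are discarded.
  Layer edges that lose their blocker are kept, so that the blockers of a layer only ever decrease;
  few layer edges are without blocker when no such exchange is possible at a lower level.
  A potential in which level \<open>i\<close> has weight \<open>C^-i\<close> decreases at each step by at least \<open>C^-i\<close> up to
  a constant, hence by the inverse of a polynomial, as the number of levels is logarithmic.
\<close>

section \<open>Polynomial-time computable functions on trees\<close>

text \<open>The cost \<open>2r - 3\<close> is \<open>(r - 1) + (r - 2)\<close>: a blocker shares a
  vertex of \<open>B\<close> with a layer edge. The root has no blocker, which leads to
  \<open>|S| - 1\<close> instead of \<open>|S|\<close>. The obstacle is that exchanges strip layer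
  edges of their blockers: such edges still cost vertices of \<open>B\<close> but no longer supply
  vertices of \<open>A\<close>. An unblocked edge is itself a candidate for an exchange at the level
  where it starts, so a maximal set of candidates must intersect it; small maximal sets therefore
  leave few unblocked edges, and greedy selection is good enough. The constants are fixed in the
  order \<open>D\<close> (from \<epsilon> and \<open>r\<close>, to absorb all errors),
  \<open>G = 4 r D^3\<close> (to keep the unblocked edges below a fraction \<open>1/D\<close> of the
  reached part), \<open>C = 2 G r + 2\<close> (to make a level outweigh those above it), and an
  exponent \<open>p\<close> with \<open>C \<le> (1 + 1/(2D))^p\<close>. The reached part of
  \<open>A\<close> grows by the factor \<open>1 + 1/(2D)\<close> per level and never exceeds
  \<open>|A|\<close>, so \<open>C\<close> to the power of the height is at most
  \<open>C (|A| + 2)^p\<close>, which is polynomial for fixed \<epsilon> and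
  \<open>r\<close>.\<close>

lemma poly_nat_mono: "x \<le> y \<Longrightarrow> poly q x \<le> poly q y" for q :: "nat poly"
  by (induction q) (auto intro!: add_mono mult_mono)

declare One_nat_def [simp del]

section \<open>Evaluation with upper bounds on the running time\<close>

definition evalb :: "program \<Rightarrow> tree list \<Rightarrow> exp \<Rightarrow> tree \<Rightarrow> nat \<Rightarrow> bool" where
  "evalb P env e v b \<longleftrightarrow> (\<exists>n\<le>b. eval P env e v n)"

lemma evalb_mono: "evalb P env e v b \<Longrightarrow> b \<le> c \<Longrightarrow> evalb P env e v c"
  unfolding evalb_def by (meson order_trans)

lemma evalb_Var: "i < length env \<Longrightarrow> v = env ! i \<Longrightarrow> evalb P env (Var i) v 1"
  unfolding evalb_def using eval_Var by blast

lemma evalb_Nil: "evalb P env ENil Leaf 1"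
  unfolding evalb_def using eval_Nil by blast

lemma evalb_Cons:
  "evalb P env a u m \<Longrightarrow> evalb P env b v n \<Longrightarrow> evalb P env (ECons a b) (Node u v) (m + n + 1)"
  unfolding evalb_def by (meson eval_Cons add_le_mono order_refl)

lemma evalb_Hd: "evalb P env a u m \<Longrightarrow> evalb P env (EHd a) (hd_tree u) (m + 1)"
  unfolding evalb_def by (meson eval_Hd add_le_mono order_refl)

lemma evalb_Tl: "evalb P env a u m \<Longrightarrow> evalb P env (ETl a) (tl_tree u) (m + 1)"
  unfolding evalb_def by (meson eval_Tl add_le_mono order_refl)

text \<open>Only the branch that is taken has to terminate; recursive bodies rely on this.\<close>

lemma evalb_If:
  assumes "evalb P env c w k" and "w \<noteq> Leaf \<Longrightarrow> evalb P env a v m"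
    and "w = Leaf \<Longrightarrow> evalb P env b v m"
  shows "evalb P env (EIf c a b) v (k + m + 1)"
proof (cases "w = Leaf")
  case True
  then show ?thesis using assms(1,3) unfolding evalb_def
    by (meson eval_IfFalse add_le_mono order_refl)
next
  case False
  then show ?thesis using assms(1,2) unfolding evalb_def
    by (meson eval_IfTrue add_le_mono order_refl)
qed

lemma evalb_Call1:
  assumes "evalb P env a u m" "f < length P" "evalb P [u] (P ! f) v n"
  shows "evalb P env (Call f [a]) v (m + n + 1)"
proof -
  obtain m' n' where m: "m' \<le> m" "eval P env a u m'" and n: "n' \<le> n" "eval P [u] (P ! f) v n'"
    using assms unfolding evalb_def by blast
  have "evals P env [a] [u] (m' + 0)" by (intro evals_Cons m evals_Nil)
  from eval_Call[OF this assms(2) n(2)] show ?thesis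
    unfolding evalb_def using m(1) n(1) by (intro exI[of _ "m' + 0 + n' + 1"] conjI) linarith+
qed

lemma evalb_Call2:
  assumes "evalb P env a u m" "evalb P env b w k" "f < length P" "evalb P [u, w] (P ! f) v n"
  shows "evalb P env (Call f [a, b]) v (m + k + n + 1)"
proof -
  obtain m' k' n' where m: "m' \<le> m" "eval P env a u m'" and k: "k' \<le> k" "eval P env b w k'"
    and n: "n' \<le> n" "eval P [u, w] (P ! f) v n'"
    using assms unfolding evalb_def by blast
  have "evals P env [a, b] [u, w] (m' + (k' + 0))" by (intro evals_Cons m k evals_Nil)
  from eval_Call[OF this assms(3) n(2)] show ?thesis
    unfolding evalb_def using m(1) k(1) n(1) by (intro exI[of _ "m' + (k' + 0) + n' + 1"] conjI) linarith+
qed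

lemma evalb_Call3:
  assumes "evalb P env a u m" "evalb P env b w k" "evalb P env c x l"
    "f < length P" "evalb P [u, w, x] (P ! f) v n"
  shows "evalb P env (Call f [a, b, c]) v (m + k + l + n + 1)"
proof -
  obtain m' k' l' n' where m: "m' \<le> m" "eval P env a u m'" and k: "k' \<le> k" "eval P env b w k'"
    and l: "l' \<le> l" "eval P env c x l'" and n: "n' \<le> n" "eval P [u, w, x] (P ! f) v n'"
    using assms unfolding evalb_def by blast
  have "evals P env [a, b, c] [u, w, x] (m' + (k' + (l' + 0)))"
    by (intro evals_Cons m k l evals_Nil)
  from eval_Call[OF this assms(4) n(2)] show ?thesis
    unfolding evalb_def using m(1) k(1) l(1) n(1) by (intro exI[of _ "m' + (k' + (l' + 0)) + n' + 1"] conjI) linarith+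
qed

section \<open>Linking programs by relocation\<close>

fun shift_exp :: "nat \<Rightarrow> exp \<Rightarrow> exp" where
  "shift_exp k (Var i) = Var i"
| "shift_exp k ENil = ENil"
| "shift_exp k (ECons a b) = ECons (shift_exp k a) (shift_exp k b)"
| "shift_exp k (EHd a) = EHd (shift_exp k a)"
| "shift_exp k (ETl a) = ETl (shift_exp k a)"
| "shift_exp k (EIf a b c) = EIf (shift_exp k a) (shift_exp k b) (shift_exp k c)"
| "shift_exp k (ELet a b) = ELet (shift_exp k a) (shift_exp k b)"
| "shift_exp k (Call f es) = Call (k + f) (map (shift_exp k) es)"

text \<open>Calls refer to absolute positions in the program, so code may be moved behind a prefix
  once all its calls are shifted; values and times stay the same.\<close>

lemma eval_shift:
  fixes pre p post
  defines "P \<equiv> pre @ map (shift_exp (length pre)) p @ post"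
  shows "eval p env e v n \<Longrightarrow> eval P env (shift_exp (length pre) e) v n"
    and "evals p env es vs m \<Longrightarrow> evals P env (map (shift_exp (length pre)) es) vs m"
proof (induction rule: eval_evals.inducts)
  case (eval_Call env es vs m f v n)
  have "length pre + f < length P" "P ! (length pre + f) = shift_exp (length pre) (p ! f)"
    using eval_Call(3) unfolding P_def by (auto simp: nth_append)
  with eval_Call.IH show ?case by (auto intro: eval_evals.eval_Call)
qed (auto intro: eval_evals.intros)

section \<open>The class of polynomial-time functions\<close>

definition computes :: "program \<Rightarrow> nat \<Rightarrow> (tree \<Rightarrow> tree) \<Rightarrow> nat poly \<Rightarrow> bool" where
  "computes P i f q \<longleftrightarrow> i < length P \<and>
     (\<forall>t. evalb P [t] (P ! i) (f t) (poly q (size t)) \<and> size (f t) \<le> poly q (size t))"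

text \<open>The size of the value is bounded separately: because of sharing, it can be exponential in
  the running time.\<close>

definition ptime :: "(tree \<Rightarrow> tree) \<Rightarrow> bool" where
  "ptime f \<longleftrightarrow> (\<exists>P q. computes P 0 f q)"

lemma ptimeI:
  assumes "length P > 0" "\<And>t. evalb P [t] (P ! 0) (f t) (poly q (size t))"
    "\<And>t. size (f t) \<le> poly q' (size t)"
  shows "ptime f"
proof -
  have "computes P 0 f (q + q')"
    unfolding computes_def using assms by (auto intro: evalb_mono trans_le_add1 trans_le_add2)
  then show ?thesis unfolding ptime_def by blast
qed

lemma computes_weaken: "computes P i f q \<Longrightarrow> (\<And>n. poly q n \<le> poly q' n) \<Longrightarrow> computes P i f q'"
  unfolding computes_def by (meson evalb_mono order_trans)

lemma computes_link:
  assumes "computes p 0 f q"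
  shows "computes (pre @ map (shift_exp (length pre)) p @ post) (length pre) f q"
proof -
  let ?P = "pre @ map (shift_exp (length pre)) p @ post"
  have p: "0 < length p" and
    f: "\<And>t. evalb p [t] (p ! 0) (f t) (poly q (size t))" "\<And>t. size (f t) \<le> poly q (size t)"
    using assms unfolding computes_def by auto
  have "?P ! length pre = shift_exp (length pre) (p ! 0)" using p by (simp add: nth_append)
  moreover have "evalb ?P [t] (shift_exp (length pre) (p ! 0)) (f t) (poly q (size t))" for t
    using f(1)[of t] eval_shift(1)[of p "[t]" "p ! 0" "f t" _ pre post] unfolding evalb_def by blast
  ultimately show ?thesis using p f(2) unfolding computes_def by simp
qed

text \<open>The prefix contains calls to the linked functions, so the indices \<open>i\<close>,
  \<open>j\<close>, \<open>k\<close> must be known before the prefix is written; hence one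
  \<open>p\<close> for all prefixes of length \<open>m\<close>. Two functions are linked by giving
  one of them twice.\<close>

lemma link3:
  assumes "ptime f" "ptime g" "ptime h"
  obtains p i j k q where "\<And>pre. length pre = m \<Longrightarrow>
    computes (pre @ p) i f q \<and> computes (pre @ p) j g q \<and> computes (pre @ p) k h q"
proof -
  obtain pf pg ph qf qg qh where
    *: "computes pf 0 f qf" "computes pg 0 g qg" "computes ph 0 h qh"
    using assms unfolding ptime_def by blast
  define j k where "j = m + length pf" and "k = m + length pf + length pg"
  let ?p = "map (shift_exp m) pf @ map (shift_exp j) pg @ map (shift_exp k) ph"
  let ?q = "qf + qg + qh"
  have "computes (pre @ ?p) m f ?q \<and> computes (pre @ ?p) j g ?q \<and> computes (pre @ ?p) k h ?q"
    if m: "length pre = m" for pre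
  proof (intro conjI)
    show "computes (pre @ ?p) m f ?q"
      using computes_link[OF *(1), of pre "map (shift_exp j) pg @ map (shift_exp k) ph"] m
      by (auto intro: computes_weaken)
    show "computes (pre @ ?p) j g ?q"
      using computes_link[OF *(2), of "pre @ map (shift_exp m) pf" "map (shift_exp k) ph"] m
      by (auto simp: j_def intro: computes_weaken)
    show "computes (pre @ ?p) k h ?q"
      using computes_link[OF *(3), of "pre @ map (shift_exp m) pf @ map (shift_exp j) pg" "[]"] m
      by (auto simp: k_def j_def add.assoc intro: computes_weaken)
  qed
  then show ?thesis using that by blast
qed

lemma evalb_computes:
  assumes "computes P i f q" "evalb P env a t m"
  shows "evalb P env (Call i [a]) (f t) (m + poly q (size t) + 1)"
  using assms unfolding computes_def by (blast intro: evalb_Call1)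

lemma computes_size: "computes P i f q \<Longrightarrow> size (f t) \<le> poly q (size t)"
  unfolding computes_def by blast

section \<open>Closure under composition, pairing and case distinction\<close>

named_theorems ptime_intros

lemma ptime_id [ptime_intros]: "ptime (\<lambda>t. t)"
  by (rule ptimeI[of "[Var 0]" _ 1 "[:0, 1:]"]) (auto intro: evalb_Var)

lemma ptime_Leaf: "ptime (\<lambda>t. Leaf)"
  by (rule ptimeI[of "[ENil]" _ 1 0]) (auto intro: evalb_Nil)

lemma ptime_comp:
  assumes "ptime f" "ptime g"
  shows "ptime (\<lambda>t. f (g t))"
proof -
  obtain p i j k q where *: "\<And>pre. length pre = 1 \<Longrightarrow>
      computes (pre @ p) i f q \<and> computes (pre @ p) j g q \<and> computes (pre @ p) k g q"
    by (rule link3[OF assms(1,2,2), of 1]) blast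
  define P where "P = [Call i [Call j [Var 0]]] @ p"
  have P: "computes P i f q" "computes P j g q"
    using *[of "[Call i [Call j [Var 0]]]"] unfolding P_def by simp_all
  have P0: "P ! 0 = Call i [Call j [Var 0]]" unfolding P_def by simp
  define Q where "Q = [:1:] + q + [:1:] + pcompose q q + [:1:]"
  have mono: "poly q (size (g t)) \<le> poly q (poly q (size t))" for t
    by (intro poly_nat_mono computes_size[OF P(2)])
  show ?thesis
  proof (rule ptimeI[of P _ Q Q])
    fix t
    have "evalb P [t] (Var 0) t 1" by (auto intro: evalb_Var)
    from evalb_computes[OF P(1) evalb_computes[OF P(2) this]]
    show "evalb P [t] (P ! 0) (f (g t)) (poly Q (size t))"
      unfolding P0 by (rule evalb_mono) (use mono[of t] in \<open>simp add: Q_def poly_pcompose\<close>)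
    show "size (f (g t)) \<le> poly Q (size t)"
      using mono[of t] computes_size[OF P(1), of "g t"] by (simp add: Q_def poly_pcompose)
  qed (simp add: P_def)
qed

lemma ptime_Node [ptime_intros]:
  assumes "ptime f" "ptime g"
  shows "ptime (\<lambda>t. Node (f t) (g t))"
proof -
  obtain p i j k q where *: "\<And>pre. length pre = 1 \<Longrightarrow>
      computes (pre @ p) i f q \<and> computes (pre @ p) j g q \<and> computes (pre @ p) k g q"
    by (rule link3[OF assms(1,2,2), of 1]) blast
  define P where "P = [ECons (Call i [Var 0]) (Call j [Var 0])] @ p"
  have P: "computes P i f q" "computes P j g q"
    using *[of "[ECons (Call i [Var 0]) (Call j [Var 0])]"] unfolding P_def by simp_all
  have P0: "P ! 0 = ECons (Call i [Var 0]) (Call j [Var 0])" unfolding P_def by simp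
  show ?thesis
  proof (rule ptimeI[of P _ "q + q + [:5:]" "q + q + [:1:]"])
    fix t
    have v: "evalb P [t] (Var 0) t 1" by (auto intro: evalb_Var)
    from evalb_Cons[OF evalb_computes[OF P(1) v] evalb_computes[OF P(2) v]]
    show "evalb P [t] (P ! 0) (Node (f t) (g t)) (poly (q + q + [:5:]) (size t))"
      unfolding P0 by (rule evalb_mono) simp
    show "size (Node (f t) (g t)) \<le> poly (q + q + [:1:]) (size t)"
      using computes_size[OF P(1), of t] computes_size[OF P(2), of t] by simp
  qed (simp add: P_def)
qed

lemma size_hd_tl: "size (hd_tree t) \<le> size t" "size (tl_tree t) \<le> size t"
  by (cases t; simp)+

lemma ptime_hd_aux: "ptime hd_tree"
proof (rule ptimeI[of "[EHd (Var 0)]" _ "1 + 1" "[:0, 1:]"])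
  fix t
  show "evalb [EHd (Var 0)] [t] ([EHd (Var 0)] ! 0) (hd_tree t) (poly (1 + 1) (size t))"
    using evalb_Hd[OF evalb_Var[of 0 "[t]" t]] by simp
qed (auto simp: size_hd_tl)

lemma ptime_tl_aux: "ptime tl_tree"
proof (rule ptimeI[of "[ETl (Var 0)]" _ "1 + 1" "[:0, 1:]"])
  fix t
  show "evalb [ETl (Var 0)] [t] ([ETl (Var 0)] ! 0) (tl_tree t) (poly (1 + 1) (size t))"
    using evalb_Tl[OF evalb_Var[of 0 "[t]" t]] by simp
qed (auto simp: size_hd_tl)

lemmas ptime_hd [ptime_intros] = ptime_comp[OF ptime_hd_aux]
lemmas ptime_tl [ptime_intros] = ptime_comp[OF ptime_tl_aux]

lemma ptime_const [ptime_intros]: "ptime (\<lambda>t. c)"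
  by (induction c) (auto intro: ptime_Leaf ptime_Node)

definition tree_of_bool :: "bool \<Rightarrow> tree" where
  "tree_of_bool b = (if b then Node Leaf Leaf else Leaf)"

lemma tree_of_bool_eq_Leaf [simp]: "tree_of_bool b = Leaf \<longleftrightarrow> \<not> b"
  by (simp add: tree_of_bool_def)

lemma ptime_If [ptime_intros]:
  assumes "ptime (\<lambda>t. tree_of_bool (c t))" "ptime f" "ptime g"
  shows "ptime (\<lambda>t. if c t then f t else g t)"
proof -
  obtain p i j k q where *: "\<And>pre. length pre = 1 \<Longrightarrow>
      computes (pre @ p) i (\<lambda>t. tree_of_bool (c t)) q \<and> computes (pre @ p) j f q
        \<and> computes (pre @ p) k g q"
    by (rule link3[OF assms, of 1]) blast
  define e where "e = EIf (Call i [Var 0]) (Call j [Var 0]) (Call k [Var 0])"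
  define P where "P = [e] @ p"
  have P: "computes P i (\<lambda>t. tree_of_bool (c t)) q" "computes P j f q" "computes P k g q"
    using *[of "[e]"] unfolding P_def by simp_all
  have P0: "P ! 0 = e" unfolding P_def by simp
  show ?thesis
  proof (rule ptimeI[of P _ "q + q + [:5:]" q])
    fix t
    have v: "evalb P [t] (Var 0) t 1" by (auto intro: evalb_Var)
    have "evalb P [t] e (if c t then f t else g t)
        ((1 + poly q (size t) + 1) + (1 + poly q (size t) + 1) + 1)"
      unfolding e_def
      by (rule evalb_If[OF evalb_computes[OF P(1) v]])
        (use evalb_computes[OF P(2) v] evalb_computes[OF P(3) v] in auto)
    then show "evalb P [t] (P ! 0) (if c t then f t else g t) (poly (q + q + [:5:]) (size t))"
      unfolding P0 by (rule evalb_mono) simp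
    show "size (if c t then f t else g t) \<le> poly q (size t)"
      using computes_size[OF P(2), of t] computes_size[OF P(3), of t] by simp
  qed (simp add: P_def)
qed

section \<open>Equality of trees\<close>

definition eq_body :: exp where
  "eq_body = EIf (Var 0)
     (EIf (Var 1)
        (EIf (Call 1 [EHd (Var 0), EHd (Var 1)]) (Call 1 [ETl (Var 0), ETl (Var 1)]) ENil) ENil)
     (EIf (Var 1) ENil (ECons ENil ENil))"

text \<open>The recursion descends in both trees at once, so the size of the first alone bounds the
  time.\<close>

lemma evalb_eq_body:
  assumes "length P > 1" "P ! 1 = eq_body"
  shows "evalb P [x, y] eq_body (tree_of_bool (x = y)) (40 * size x + 20)"
proof (induction x arbitrary: y)
  case Leaf
  have "evalb P [Leaf, y] eq_body (tree_of_bool (Leaf = y)) (1 + (1 + 3 + 1) + 1)"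
    unfolding eq_body_def
    by (rule evalb_If[OF evalb_Var], simp, simp, simp, rule evalb_If[OF evalb_Var])
      (auto simp: tree_of_bool_def
        intro: evalb_mono[OF evalb_Nil] evalb_mono[OF evalb_Cons[OF evalb_Nil evalb_Nil]])
  then show ?case by (rule evalb_mono) simp
next
  case (Node l r)
  show ?case
  proof (cases y)
    case Leaf
    have "evalb P [Node l r, y] eq_body (tree_of_bool (Node l r = y)) (1 + (1 + 1 + 1) + 1)"
      unfolding eq_body_def
      by (rule evalb_If[OF evalb_Var], simp, simp, rule evalb_If[OF evalb_Var])
        (auto simp: Leaf tree_of_bool_def intro: evalb_Nil)
    then show ?thesis by (rule evalb_mono) simp
  next
    case (Node l' r')
    have 1: "evalb P [Node l r, y] (EHd (Var 0)) l 2" "evalb P [Node l r, y] (EHd (Var 1)) l' 2"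
      "evalb P [Node l r, y] (ETl (Var 0)) r 2" "evalb P [Node l r, y] (ETl (Var 1)) r' 2"
      using evalb_Hd[OF evalb_Var[of 0 "[Node l r, y]"], of _ P]
        evalb_Hd[OF evalb_Var[of 1 "[Node l r, y]"], of _ P]
        evalb_Tl[OF evalb_Var[of 0 "[Node l r, y]"], of _ P]
        evalb_Tl[OF evalb_Var[of 1 "[Node l r, y]"], of _ P] Node
      by (auto simp: numeral_2_eq_2)
    have 2: "evalb P [Node l r, y] (Call 1 [EHd (Var 0), EHd (Var 1)]) (tree_of_bool (l = l'))
        (2 + 2 + (40 * size l + 20) + 1)"
      by (rule evalb_Call2[OF 1(1,2)]) (use assms Node.IH(1)[of l'] in auto)
    have 3: "evalb P [Node l r, y] (Call 1 [ETl (Var 0), ETl (Var 1)]) (tree_of_bool (r = r'))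
        (2 + 2 + (40 * size r + 20) + 1)"
      by (rule evalb_Call2[OF 1(3,4)]) (use assms Node.IH(2)[of r'] in auto)
    have 4: "evalb P [Node l r, y]
        (EIf (Call 1 [EHd (Var 0), EHd (Var 1)]) (Call 1 [ETl (Var 0), ETl (Var 1)]) ENil)
        (tree_of_bool (Node l r = y))
        ((2 + 2 + (40 * size l + 20) + 1) + (2 + 2 + (40 * size r + 20) + 1) + 1)"
    proof (rule evalb_If[OF 2])
      assume "tree_of_bool (l = l') \<noteq> Leaf"
      then show "evalb P [Node l r, y] (Call 1 [ETl (Var 0), ETl (Var 1)])
          (tree_of_bool (Node l r = y)) (2 + 2 + (40 * size r + 20) + 1)"
        using 3 Node by simp
    next
      assume "tree_of_bool (l = l') = Leaf"
      then have e: "tree_of_bool (Node l r = y) = Leaf" using Node by simp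
      show "evalb P [Node l r, y] ENil (tree_of_bool (Node l r = y))
          (2 + 2 + (40 * size r + 20) + 1)"
        unfolding e by (rule evalb_mono[OF evalb_Nil]) simp
    qed
    have "evalb P [Node l r, y] eq_body (tree_of_bool (Node l r = y))
        (1 + (1 + ((2 + 2 + (40 * size l + 20) + 1) + (2 + 2 + (40 * size r + 20) + 1) + 1) + 1) + 1)"
      unfolding eq_body_def
    proof (rule evalb_If)
      show "evalb P [Node l r, y] (Var 0) (Node l r) 1" by (auto intro: evalb_Var)
      have "evalb P [Node l r, y] (Var 1) y 1"
        using evalb_Var[of 1 "[Node l r, y]" y P] by (simp add: One_nat_def)
      then show "evalb P [Node l r, y]
          (EIf (Var 1)
            (EIf (Call 1 [EHd (Var 0), EHd (Var 1)]) (Call 1 [ETl (Var 0), ETl (Var 1)]) ENil) ENil)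
          (tree_of_bool (Node l r = y))
          (1 + ((2 + 2 + (40 * size l + 20) + 1) + (2 + 2 + (40 * size r + 20) + 1) + 1) + 1)"
        by (rule evalb_If) (use 4 in \<open>auto simp: Node\<close>)
    qed auto
    then show ?thesis by (rule evalb_mono) simp
  qed
qed

lemma ptime_eq_aux: "ptime (\<lambda>z. tree_of_bool (hd_tree z = tl_tree z))"
proof (rule ptimeI[of "[Call 1 [EHd (Var 0), ETl (Var 0)], eq_body]" _ "[:25, 40:]" 1])
  fix z
  let ?P = "[Call 1 [EHd (Var 0), ETl (Var 0)], eq_body]"
  have v: "evalb ?P [z] (Var 0) z 1" by (auto intro: evalb_Var)
  have "evalb ?P [z] (Call 1 [EHd (Var 0), ETl (Var 0)]) (tree_of_bool (hd_tree z = tl_tree z))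
      ((1 + 1) + (1 + 1) + (40 * size (hd_tree z) + 20) + 1)"
    by (rule evalb_Call2[OF evalb_Hd[OF v] evalb_Tl[OF v]]) (auto simp: One_nat_def intro!: evalb_eq_body)
  then show "evalb ?P [z] (?P ! 0) (tree_of_bool (hd_tree z = tl_tree z)) (poly [:25, 40:] (size z))"
    unfolding nth_Cons_0 by (rule evalb_mono) (use size_hd_tl[of z] in simp)
qed (auto simp: tree_of_bool_def)

lemma ptime_eq [ptime_intros]:
  assumes "ptime f" "ptime g"
  shows "ptime (\<lambda>t. tree_of_bool (f t = g t))"
  using ptime_comp[OF ptime_eq_aux ptime_Node[OF assms]] by simp

section \<open>Lists and bounded iteration\<close>

fun els :: "tree \<Rightarrow> tree list" where
  "els Leaf = []"
| "els (Node x t) = x # els t"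

lemma els_tree_of_list [simp]: "els (tree_of_list xs) = xs"
  by (induction xs) auto

lemma tree_of_list_els [simp]: "tree_of_list (els t) = t"
  by (induction t) auto

text \<open>\<open>els\<close> does not return a tree, so list arguments occur under
  \<open>tree_of_list\<close>; this rule reads such an argument off a tree.\<close>

lemma ptime_els [ptime_intros]: "ptime f \<Longrightarrow> ptime (\<lambda>t. tree_of_list (els (f t)))"
  by simp

lemma size_els: "x \<in> set (els t) \<Longrightarrow> size x < size t" "length (els t) \<le> size t"
  by (induction t) auto

text \<open>The bound on the step makes the size of the accumulator grow only linearly with the number
  of steps, as in bounded recursion on notation.\<close>

lemma ptime_foldl:
  assumes "ptime f" "ptime g"
    and h: "ptime (\<lambda>z. h (hd_tree z) (hd_tree (tl_tree z)) (tl_tree (tl_tree z)))"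
    and bound: "\<And>t s x. size (h t s x) \<le> size s + poly d (size t + size x)"
  shows "ptime (\<lambda>t. foldl (h t) (f t) (els (g t)))"
proof -
  let ?h = "\<lambda>z. h (hd_tree z) (hd_tree (tl_tree z)) (tl_tree (tl_tree z))"
  obtain p i j k q where *: "\<And>pre. length pre = 2 \<Longrightarrow>
      computes (pre @ p) i f q \<and> computes (pre @ p) j g q \<and> computes (pre @ p) k ?h q"
    by (rule link3[OF assms(1,2) h, of 2]) blast
  define e where "e = Call 1 [Var 0, Call i [Var 0], Call j [Var 0]]"
  define l where "l = EIf (Var 2)
     (Call 1 [Var 0, Call k [ECons (Var 0) (ECons (Var 1) (EHd (Var 2)))], ETl (Var 2)]) (Var 1)"
  define P where "P = [e, l] @ p"
  have P: "computes P i f q" "computes P j g q" "computes P k ?h q"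
    using *[of "[e, l]"] unfolding P_def by simp_all
  have P0: "P ! 0 = e" "P ! 1 = l" "length P > 1" unfolding P_def by auto
  \<comment> \<open>The quantity bounded by \<open>b\<close> does not increase: each round shortens
    the list by one and enlarges the accumulator by at most one summand
    \<open>poly d (size t + c)\<close>. It dominates the size of the argument \<open>z\<close> of
    the step function; the 2 counts the two constructors of \<open>z\<close>.\<close>
  have loop: "evalb P [t, s, xs] l (foldl (h t) s (els xs)) ((poly q b + 20) * length (els xs) + 3)"
      (is "?ev t s xs") and
    len: "size (foldl (h t) s (els xs)) \<le> size s + length (els xs) * poly d (size t + c)"
      (is "?sz t s xs")
    if b: "size t + size s + length (els xs) * poly d (size t + c) + c + 2 \<le> b" and
       c: "\<forall>x\<in>set (els xs). size x \<le> c" for t s xs b c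
    using that
  proof (induction xs arbitrary: s)
    case Leaf
    { case 1
      have "evalb P [t, s, Leaf] l s (1 + 1 + 1)"
        unfolding l_def by (rule evalb_If) (auto intro: evalb_Var)
      then show ?case by (simp add: numeral_3_eq_3)
    next
      case 2 then show ?case by simp }
  next
    case (Node x xs)
    { fix s :: tree
      assume prem: "size t + size s + length (els (Node x xs)) * poly d (size t + c) + c + 2 \<le> b"
        "\<forall>x\<in>set (els (Node x xs)). size x \<le> c"
      have "size (h t s x) \<le> size s + poly d (size t + size x)" by (rule bound)
      also have "\<dots> \<le> size s + poly d (size t + c)"
        using prem(2) by (auto intro: poly_nat_mono)
      finally have hs: "size (h t s x) \<le> size s + poly d (size t + c)" .
      then have "size t + size (h t s x) + length (els xs) * poly d (size t + c) + c + 2 \<le> b"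
        using prem(1) by simp
      moreover have "\<forall>x\<in>set (els xs). size x \<le> c" using prem(2) by simp
      ultimately have "?ev t (h t s x) xs" "?sz t (h t s x) xs"
        using Node.IH(3,4)[of "h t s x"] by blast+
      note this hs
    } note step = this
    { case (1 s)
      let ?env = "[t, s, Node x xs]"
      define z where "z = Node t (Node s x)"
      have v: "evalb P ?env (Var 0) t 1" "evalb P ?env (Var 1) s 1"
        "evalb P ?env (Var 2) (Node x xs) 1"
        by (auto intro: evalb_Var)
      have arg: "evalb P ?env (ECons (Var 0) (ECons (Var 1) (EHd (Var 2)))) z 6"
        using evalb_Cons[OF v(1) evalb_Cons[OF v(2) evalb_Hd[OF v(3)]]] unfolding z_def by simp
      have "evalb P ?env (Call k [ECons (Var 0) (ECons (Var 1) (EHd (Var 2)))]) (?h z)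
          (6 + poly q (size z) + 1)"
        by (rule evalb_computes[OF P(3) arg])
      then have a2: "evalb P ?env (Call k [ECons (Var 0) (ECons (Var 1) (EHd (Var 2)))]) (h t s x)
          (6 + poly q b + 1)"
        unfolding z_def hd_tree.simps tl_tree.simps
        by (rule evalb_mono) (use 1 in \<open>auto intro!: poly_nat_mono\<close>)
      have "evalb P ?env (Call 1 [Var 0, Call k [ECons (Var 0) (ECons (Var 1) (EHd (Var 2)))],
            ETl (Var 2)]) (foldl (h t) (h t s x) (els xs))
          (1 + (6 + poly q b + 1) + (1 + 1) + ((poly q b + 20) * length (els xs) + 3) + 1)"
        by (rule evalb_Call3[OF v(1) a2 evalb_Tl[OF v(3)]])
          (use step(1)[OF 1] P0 in auto)
      then have "evalb P ?env l (foldl (h t) (h t s x) (els xs))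
          (1 + (1 + (6 + poly q b + 1) + (1 + 1) + ((poly q b + 20) * length (els xs) + 3) + 1) + 1)"
        unfolding l_def by (intro evalb_If[OF v(3)]) auto
      then show ?case by (simp, elim evalb_mono) simp
    next
      case (2 s)
      show ?case using step(2,3)[OF 2] by simp
    }
  qed
  \<comment> \<open>\<open>B\<close> is the bound \<open>b\<close> of the loop for the initial
    accumulator \<open>f t\<close> and \<open>c = size (g t)\<close>, with both sizes replaced by
    \<open>q\<close>.\<close>
  define B where "B = [:0, 1:] + q + q * pcompose d ([:0, 1:] + q) + q + [:2:]"
  define T where "T = q + q + (pcompose q B + [:20:]) * q + [:20:]"
  have B: "size t + size (f t) + length (els (g t)) * poly d (size t + size (g t)) + size (g t) + 2
      \<le> poly B (size t)" for t
  proof -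
    have g: "size (g t) \<le> poly q (size t)" by (rule computes_size[OF P(2)])
    have "length (els (g t)) * poly d (size t + size (g t))
        \<le> poly q (size t) * poly d (size t + poly q (size t))"
      by (intro mult_mono poly_nat_mono add_left_mono g order_trans[OF size_els(2) g]) auto
    then show ?thesis
      using g computes_size[OF P(1), of t] by (simp add: B_def poly_pcompose)
  qed
  show ?thesis
  proof (rule ptimeI[of P _ T B])
    fix t
    have v: "evalb P [t] (Var 0) t 1" by (auto intro: evalb_Var)
    have c: "\<forall>x\<in>set (els (g t)). size x \<le> size (g t)" using size_els(1) by (meson less_imp_le)
    have "evalb P [t] e (foldl (h t) (f t) (els (g t)))
      (1 + (1 + poly q (size t) + 1) + (1 + poly q (size t) + 1)
        + ((poly q (poly B (size t)) + 20) * length (els (g t)) + 3) + 1)"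
      unfolding e_def
      by (rule evalb_Call3[OF v evalb_computes[OF P(1) v] evalb_computes[OF P(2) v]])
        (use P0 loop[OF B c] in auto)
    then have "evalb P [t] e (foldl (h t) (f t) (els (g t))) (poly T (size t))"
    proof (rule evalb_mono)
      have "(poly q (poly B (size t)) + 20) * length (els (g t))
          \<le> (poly q (poly B (size t)) + 20) * poly q (size t)"
        by (intro mult_left_mono order_trans[OF size_els(2)] computes_size[OF P(2)]) auto
      then show "1 + (1 + poly q (size t) + 1) + (1 + poly q (size t) + 1)
        + ((poly q (poly B (size t)) + 20) * length (els (g t)) + 3) + 1 \<le> poly T (size t)"
        unfolding T_def poly_pcompose poly_add poly_mult by (simp add: trans_le_add2)
    qed
    then show "evalb P [t] (P ! 0) (foldl (h t) (f t) (els (g t))) (poly T (size t))"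
      unfolding P0 .
    show "size (foldl (h t) (f t) (els (g t))) \<le> poly B (size t)"
      using len[OF B c] B[of t] by linarith
  qed (simp add: P_def)
qed


section \<open>List operations in polynomial time\<close>

lemma ptime_Cons [ptime_intros]:
  "ptime f \<Longrightarrow> ptime (\<lambda>t. tree_of_list (g t)) \<Longrightarrow> ptime (\<lambda>t. tree_of_list (f t # g t))"
  by (simp add: ptime_Node)

lemma ptime_If_list [ptime_intros]:
  assumes "ptime (\<lambda>t. tree_of_bool (c t))" "ptime (\<lambda>t. tree_of_list (f t))"
    "ptime (\<lambda>t. tree_of_list (g t))"
  shows "ptime (\<lambda>t. tree_of_list (if c t then f t else g t))"
  using ptime_If[OF assms] by (simp add: if_distrib cong: if_cong)

lemma ptime_rev_append:
  assumes "ptime (\<lambda>t. tree_of_list (f t))" "ptime (\<lambda>t. tree_of_list (g t))"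
  shows "ptime (\<lambda>t. tree_of_list (rev (f t) @ g t))"
proof -
  have *: "foldl (\<lambda>s x. Node x s) (tree_of_list ys) xs = tree_of_list (rev xs @ ys)" for xs ys
    by (induction xs arbitrary: ys) (auto simp flip: tree_of_list.simps)
  have "ptime (\<lambda>t. foldl (\<lambda>s x. Node x s) (tree_of_list (g t)) (els (tree_of_list (f t))))"
    by (rule ptime_foldl[where d = "[:1, 1:]"]) (intro ptime_intros assms | simp)+
  then show ?thesis by (simp add: *)
qed

lemma ptime_rev: "ptime (\<lambda>t. tree_of_list (f t)) \<Longrightarrow> ptime (\<lambda>t. tree_of_list (rev (f t)))"
  using ptime_rev_append[of f "\<lambda>t. []"] ptime_const by simp

lemma ptime_append [ptime_intros]:
  assumes "ptime (\<lambda>t. tree_of_list (f t))" "ptime (\<lambda>t. tree_of_list (g t))"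
  shows "ptime (\<lambda>t. tree_of_list (f t @ g t))"
  using ptime_rev_append[OF ptime_rev[OF assms(1)] assms(2)] by simp

lemma size_tree_of_list: "size (tree_of_list xs) = (\<Sum>x\<leftarrow>xs. size x + 1)"
  by (induction xs) auto

lemma ptime_foldl_list:
  assumes "ptime (\<lambda>t. tree_of_list (f t))" "ptime (\<lambda>t. tree_of_list (g t))"
    and "ptime (\<lambda>z. tree_of_list (h (hd_tree z) (els (hd_tree (tl_tree z))) (tl_tree (tl_tree z))))"
    and "\<And>t s x. size (tree_of_list (h t s x)) \<le> size (tree_of_list s) + poly d (size t + size x)"
  shows "ptime (\<lambda>t. tree_of_list (foldl (h t) (f t) (g t)))"
proof -
  have *: "foldl (\<lambda>s x. tree_of_list (h t (els s) x)) (tree_of_list ys) xs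
      = tree_of_list (foldl (h t) ys xs)" for t xs ys
    by (induction xs arbitrary: ys) auto
  have "ptime (\<lambda>t. foldl (\<lambda>s x. tree_of_list (h t (els s) x)) (tree_of_list (f t))
      (els (tree_of_list (g t))))"
    by (rule ptime_foldl[where d = d]) (use assms(1-3) assms(4)[of _ "els _"] in auto)
  then show ?thesis by (simp add: *)
qed

definition cat :: "tree list \<Rightarrow> tree list" where
  "cat xs = concat (map els xs)"

lemma set_cat: "set (cat xs) = (\<Union>x\<in>set xs. set (els x))"
  by (simp add: cat_def)

lemma ptime_cat [ptime_intros]:
  assumes "ptime (\<lambda>t. tree_of_list (f t))"
  shows "ptime (\<lambda>t. tree_of_list (cat (f t)))"
proof -
  have *: "foldl (\<lambda>s x. s @ els x) ys xs = ys @ cat xs" for xs ys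
    by (induction xs arbitrary: ys) (auto simp: cat_def)
  have "ptime (\<lambda>t. tree_of_list (foldl (\<lambda>s x. s @ els x) [] (f t)))"
  proof (rule ptime_foldl_list[where d = "[:0, 1:]"])
    show "size (tree_of_list (s @ els x)) \<le> size (tree_of_list s) + poly [:0, 1:] (size t + size x)"
      for s t x using size_tree_of_list[of "els x"] by (simp add: size_tree_of_list)
  qed (intro ptime_intros assms)+
  then show ?thesis by (simp add: *)
qed

lemma ptime_filter [ptime_intros]:
  assumes "ptime (\<lambda>t. tree_of_list (f t))" "ptime (\<lambda>z. tree_of_bool (P (hd_tree z) (tl_tree z)))"
  shows "ptime (\<lambda>t. tree_of_list (filter (P t) (f t)))"
proof -
  \<comment> \<open>The assumption treats \<open>P\<close> as a predicate on pairs; composition with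
    \<open>Node\<close> makes it a rule for arbitrary arguments of \<open>P\<close>.\<close>
  note [ptime_intros] = ptime_comp[OF assms(2), of "\<lambda>z. Node (f z) (g z)" for f g, simplified]
  have *: "foldl (\<lambda>s x. if P t x then x # s else s) ys xs = rev (filter (P t) xs) @ ys" for t xs ys
    by (induction xs arbitrary: ys) auto
  \<comment> \<open>The fold reverses the order, so the list is reversed beforehand.\<close>
  have "ptime (\<lambda>t. tree_of_list (foldl (\<lambda>s x. if P t x then x # s else s) [] (rev (f t))))"
    by (rule ptime_foldl_list[where d = "[:1, 1:]"])
      (intro ptime_intros ptime_rev assms | simp)+
  then show ?thesis by (simp add: * flip: rev_filter)
qed

lemma ptime_bex [ptime_intros]:
  assumes "ptime (\<lambda>t. tree_of_list (f t))" "ptime (\<lambda>z. tree_of_bool (P (hd_tree z) (tl_tree z)))"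
  shows "ptime (\<lambda>t. tree_of_bool (\<exists>x\<in>set (f t). P t x))"
proof -
  note [ptime_intros] = ptime_comp[OF assms(2), of "\<lambda>z. Node (f z) (g z)" for f g, simplified]
  have *: "foldl (\<lambda>s x. if P t x then Node Leaf Leaf else s) (tree_of_bool b) xs
      = tree_of_bool (b \<or> (\<exists>x\<in>set xs. P t x))" for t xs b
  proof (induction xs arbitrary: b)
    case (Cons x xs)
    have "(if P t x then Node Leaf Leaf else tree_of_bool b) = tree_of_bool (b \<or> P t x)"
      by (simp add: tree_of_bool_def)
    with Cons show ?case by auto
  qed simp
  have "ptime (\<lambda>t. foldl (\<lambda>s x. if P t x then Node Leaf Leaf else s) (tree_of_bool False)
      (els (tree_of_list (f t))))"
    by (rule ptime_foldl[where d = "[:1:]"]) (intro ptime_intros assms | simp)+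
  then show ?thesis unfolding * by simp
qed

lemma ptime_mem [ptime_intros]:
  assumes "ptime f" "ptime (\<lambda>t. tree_of_list (g t))"
  shows "ptime (\<lambda>t. tree_of_bool (f t \<in> set (g t)))"
proof -
  note [ptime_intros] = assms[THEN ptime_comp]
  have "ptime (\<lambda>t. tree_of_bool (\<exists>x\<in>set (g t). f t = x))"
    by (intro ptime_intros)
  then show ?thesis by (simp add: Bex_def)
qed

lemma ptime_Not [ptime_intros]:
  assumes "ptime (\<lambda>t. tree_of_bool (f t))"
  shows "ptime (\<lambda>t. tree_of_bool (\<not> f t))"
proof -
  have "(if f t then Leaf else Node Leaf Leaf) = tree_of_bool (\<not> f t)" for t
    by (simp add: tree_of_bool_def)
  then show ?thesis
    using ptime_If[OF assms ptime_const[of Leaf] ptime_const[of "Node Leaf Leaf"]] by simp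
qed

lemma ptime_conj [ptime_intros]:
  assumes "ptime (\<lambda>t. tree_of_bool (f t))" "ptime (\<lambda>t. tree_of_bool (g t))"
  shows "ptime (\<lambda>t. tree_of_bool (f t \<and> g t))"
proof -
  have "(if f t then tree_of_bool (g t) else Leaf) = tree_of_bool (f t \<and> g t)" for t
    by (simp add: tree_of_bool_def)
  then show ?thesis using ptime_If[OF assms(1,2) ptime_const[of Leaf]] by simp
qed

section \<open>Arithmetic in unary\<close>

definition unary :: "nat \<Rightarrow> tree" where
  "unary n = tree_of_list (replicate n Leaf)"

lemma ptime_length [ptime_intros]:
  assumes "ptime (\<lambda>t. tree_of_list (f t))"
  shows "ptime (\<lambda>t. unary (length (f t)))"
proof -
  have *: "foldl (\<lambda>s x. Node Leaf s) (unary n) xs = unary (n + length xs)" for xs n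
    by (induction xs arbitrary: n) (auto simp: unary_def simp flip: tree_of_list.simps replicate_Suc)
  have "ptime (\<lambda>t. foldl (\<lambda>s x. Node Leaf s) (unary 0) (els (tree_of_list (f t))))"
    by (rule ptime_foldl[where d = "[:1:]"]) (intro ptime_intros assms | simp)+
  then show ?thesis unfolding * by simp
qed

lemma ptime_add [ptime_intros]:
  "ptime (\<lambda>t. unary (f t)) \<Longrightarrow> ptime (\<lambda>t. unary (g t)) \<Longrightarrow> ptime (\<lambda>t. unary (f t + g t))"
  unfolding unary_def replicate_add by (rule ptime_append)

text \<open>A product is the length of \<open>g t\<close> concatenated copies of
  \<open>unary (f t)\<close>. The copies grow with \<open>t\<close>, which is a reason for letting
  the step bound in \<open>ptime_foldl\<close> depend on \<open>size t\<close>.\<close>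

lemma ptime_mult [ptime_intros]:
  assumes "ptime (\<lambda>t. unary (f t))" "ptime (\<lambda>t. unary (g t))"
  shows "ptime (\<lambda>t. unary (f t * g t))"
proof -
  have "ptime (\<lambda>t. tree_of_list (cat (map (\<lambda>x. unary (f t)) (replicate (g t) Leaf))))"
  proof -
    have *: "foldl (\<lambda>s x. Node c s) (tree_of_list ys) xs = tree_of_list (map (\<lambda>x. c) xs @ ys)"
      for c ys and xs :: "tree list"
      by (induction xs arbitrary: ys) (auto simp: map_replicate_const replicate_app_Cons_same
            simp flip: tree_of_list.simps)
    obtain p q where "computes p 0 (\<lambda>t. unary (f t)) q" using assms(1) unfolding ptime_def by blast
    then have q: "size (unary (f t)) \<le> poly q (size t)" for t by (rule computes_size)
    have "ptime (\<lambda>t. foldl (\<lambda>s x. Node (unary (f t)) s) (tree_of_list [])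
        (els (tree_of_list (replicate (g t) Leaf))))"
    proof (rule ptime_foldl[where d = "q + 1"])
      show "size (Node (unary (f t)) s) \<le> size s + poly (q + 1) (size t + size x)" for t s x
        using order_trans[OF q[of t] poly_nat_mono[of "size t" "size t + size x" q]] by simp
    qed (use assms(2) in \<open>intro ptime_intros ptime_comp[OF assms(1)] | simp add: unary_def\<close>)+
    then have "ptime (\<lambda>t. tree_of_list (map (\<lambda>x. unary (f t)) (replicate (g t) Leaf)))"
      unfolding * by simp
    then show ?thesis by (rule ptime_cat)
  qed
  moreover have "cat (map (\<lambda>x. unary n) (replicate m Leaf)) = replicate (n * m) Leaf" for n m
    by (induction m) (auto simp: cat_def unary_def replicate_add)
  ultimately show ?thesis by (simp add: unary_def)
qed

lemma ptime_power [ptime_intros]: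
  "ptime (\<lambda>t. unary (f t)) \<Longrightarrow> ptime (\<lambda>t. unary (f t ^ k))"
  by (induction k) (auto intro: ptime_intros)

text \<open>Truncated subtraction decides the order: \<open>tl_tree\<close> fixes
  \<open>Leaf\<close>, so dropping \<open>g t\<close> entries of \<open>unary (f t)\<close> leaves
  \<open>Leaf\<close> exactly if \<open>f t \<le> g t\<close>.\<close>

lemma ptime_le [ptime_intros]:
  assumes "ptime (\<lambda>t. unary (f t))" "ptime (\<lambda>t. unary (g t))"
  shows "ptime (\<lambda>t. tree_of_bool (f t \<le> g t))"
proof -
  have *: "foldl (\<lambda>s x. tl_tree s) (unary n) xs = unary (n - length xs)" for n and xs :: "tree list"
  proof (induction xs arbitrary: n)
    case (Cons x xs)
    have "tl_tree (unary n) = unary (n - 1)" by (cases n) (auto simp: unary_def)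
    with Cons show ?case by (simp add: One_nat_def)
  qed simp
  have "ptime (\<lambda>t. foldl (\<lambda>s x. tl_tree s) (unary (f t)) (els (unary (g t))))"
    by (rule ptime_foldl[where d = 0]) (intro ptime_intros assms | simp add: size_hd_tl)+
  then have "ptime (\<lambda>t. tree_of_bool (unary (f t - g t) = Leaf))"
    unfolding * by (intro ptime_intros) (simp add: unary_def)
  moreover have "unary (m - n) = Leaf \<longleftrightarrow> m \<le> n" for m n
    by (cases "m - n") (auto simp: unary_def)
  ultimately show ?thesis by simp
qed

declare One_nat_def [simp]

section \<open>Layers of alternating trees\<close>

lemma card_pairwise_disjnt_le:
  assumes "pairwise disjnt X" "finite V" "\<And>x. x \<in> X \<Longrightarrow> x \<inter> V \<noteq> {}"
  shows "card X \<le> card V"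
proof (rule card_le_if_inj_on_rel[where r = "\<lambda>x v. v \<in> x"])
  show "x = y" if "x \<in> X" "y \<in> X" "v \<in> x" "v \<in> y" for x y v
    using assms(1) that unfolding pairwise_def disjnt_def by blast
qed (use assms in auto)

lemma card_Union_le_mult:
  assumes "\<And>x. x \<in> X \<Longrightarrow> card x \<le> k"
  shows "card (\<Union>X) \<le> k * card X"
proof (cases "finite X")
  case True
  have "card (\<Union>X) \<le> (\<Sum>x\<in>X. card x)" by (rule card_Union_le_sum_card)
  also have "\<dots> \<le> (\<Sum>x\<in>X. k)" by (rule sum_mono) (rule assms)
  finally show ?thesis by (simp add: mult.commute)
next
  case False
  then have "infinite (\<Union>X)" by (meson finite_UnionD)
  then show ?thesis by simp
qed

locale bipartite_hypergraph =
  fixes r :: nat and A B :: "'a set" and E :: "'a set set"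
  assumes uniform: "uniform_bipartite_hypergraph r A B E" and r2: "r \<ge> 2"
begin

lemma finite_A: "finite A" and finite_B: "finite B" and A_B: "A \<inter> B = {}"
  using uniform unfolding uniform_bipartite_hypergraph_def by auto

lemma edge_subset: "e \<in> E \<Longrightarrow> e \<subseteq> A \<union> B"
  and edge_card_B: "e \<in> E \<Longrightarrow> card (e \<inter> B) = r - 1"
  using uniform unfolding uniform_bipartite_hypergraph_def by auto

lemma edge_A: "e \<in> E \<Longrightarrow> \<exists>a. e \<inter> A = {a}"
  using uniform unfolding uniform_bipartite_hypergraph_def by (auto simp: card_1_singleton_iff)

lemma edge_A_eq: "e \<in> E \<Longrightarrow> v \<in> e \<Longrightarrow> v \<in> A \<Longrightarrow> w \<in> e \<Longrightarrow> w \<in> A \<Longrightarrow> v = w"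
proof -
  assume e: "e \<in> E" "v \<in> e" "v \<in> A" "w \<in> e" "w \<in> A"
  obtain a where a: "e \<inter> A = {a}" using edge_A[OF e(1)] by blast
  have "v \<in> e \<inter> A" "w \<in> e \<inter> A" using e by simp_all
  then show "v = w" unfolding a by simp
qed

lemma edge_B_nonempty: "e \<in> E \<Longrightarrow> e \<inter> B \<noteq> {}"
  using edge_card_B r2 by fastforce

lemma edge_finite: "e \<in> E \<Longrightarrow> finite e"
  using edge_subset finite_A finite_B by (meson finite_UnI finite_subset)

lemma edge_card: "e \<in> E \<Longrightarrow> card e = r"
proof -
  assume e: "e \<in> E"
  have "e = (e \<inter> A) \<union> (e \<inter> B)" using edge_subset[OF e] by blast
  moreover have "card ((e \<inter> A) \<union> (e \<inter> B)) = card (e \<inter> A) + card (e \<inter> B)"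
    using A_B finite_A finite_B by (intro card_Un_disjoint) auto
  moreover have "card (e \<inter> A) = 1" using edge_A[OF e] by auto
  ultimately show ?thesis using edge_card_B[OF e] r2 by simp
qed

lemma finite_E: "finite E"
  using edge_subset finite_A finite_B by (meson Pow_iff finite_Pow_iff finite_UnI finite_subset subsetI)

section \<open>Matchings, blockers and layers\<close>

definition matching :: "'a set set \<Rightarrow> bool" where
  "matching M \<longleftrightarrow> M \<subseteq> E \<and> pairwise disjnt M"

definition blockers :: "'a set set \<Rightarrow> 'a set set \<Rightarrow> 'a set set" where
  "blockers M X = {f \<in> M. f \<inter> B \<inter> \<Union>X \<noteq> {}}"

text \<open>The summand 1 stands for the root. For an uncovered root in \<open>A\<close> this is the
  number of reached vertices of \<open>A\<close>, see \<open>num_le_reach\<close>.\<close>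

definition num :: "'a set set \<Rightarrow> 'a set set list \<Rightarrow> nat" where
  "num M K = 1 + card (blockers M (\<Union>(set K)))"

definition reach :: "'a set set \<Rightarrow> 'a \<Rightarrow> 'a set set list \<Rightarrow> 'a set" where
  "reach M a K = {a} \<union> \<Union>(blockers M (\<Union>(set K)))"

definition used :: "'a set set \<Rightarrow> 'a set set list \<Rightarrow> 'a set" where
  "used M K = B \<inter> (\<Union>(\<Union>(set K)) \<union> \<Union>(blockers M (\<Union>(set K))))"

text \<open>Stacks have the topmost layer first.\<close>

fun layers :: "nat \<Rightarrow> 'a set set \<Rightarrow> 'a \<Rightarrow> 'a set set list \<Rightarrow> bool" where
  "layers D M a [] \<longleftrightarrow> True"
| "layers D M a (X # K) \<longleftrightarrow> layers D M a K \<and> X \<subseteq> E \<and> pairwise disjnt X \<and>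
     (\<forall>e\<in>X. e \<inter> reach M a K \<noteq> {} \<and> e \<inter> used M K = {}) \<and>
     (\<forall>f\<in>blockers M X. \<forall>e\<in>X. \<forall>e'\<in>X. f \<inter> B \<inter> e \<noteq> {} \<longrightarrow> f \<inter> B \<inter> e' \<noteq> {} \<longrightarrow> e = e') \<and>
     num M K \<le> D * card X"

text \<open>The outcome of a greedy selection of edges that meet \<open>S\<close> and avoid \<open>W\<close>, where the choice of
  an edge also forbids the edges of the matching that it meets.\<close>

definition greedy_choice :: "'a set set \<Rightarrow> 'a set \<Rightarrow> 'a set \<Rightarrow> 'a set set \<Rightarrow> bool" where
  "greedy_choice M S W X \<longleftrightarrow> X \<subseteq> E \<and> pairwise disjnt X \<and> (\<forall>e\<in>X. e \<inter> S \<noteq> {} \<and> e \<inter> W = {}) \<and>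
     (\<forall>f\<in>M. \<forall>e\<in>X. \<forall>e'\<in>X. f \<inter> B \<inter> e \<noteq> {} \<longrightarrow> f \<inter> B \<inter> e' \<noteq> {} \<longrightarrow> e = e') \<and>
     (\<forall>e\<in>E. e \<inter> S \<noteq> {} \<longrightarrow> e \<inter> (W \<union> \<Union>X \<union> (B \<inter> \<Union>{f \<in> M. f \<inter> \<Union>X \<noteq> {}})) \<noteq> {})"

lemma greedy_choiceD:
  assumes "greedy_choice M S W X"
  shows "X \<subseteq> E" "pairwise disjnt X" "\<And>e. e \<in> X \<Longrightarrow> e \<inter> S \<noteq> {}" "\<And>e. e \<in> X \<Longrightarrow> e \<inter> W = {}"
    "\<And>e. e \<in> E \<Longrightarrow> e \<inter> S \<noteq> {} \<Longrightarrow>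
      e \<inter> (W \<union> \<Union>X \<union> (B \<inter> \<Union>{f \<in> M. f \<inter> \<Union>X \<noteq> {}})) \<noteq> {}"
  using assms unfolding greedy_choice_def by simp_all

fun target :: "'a set set \<Rightarrow> 'a \<Rightarrow> 'a set set list \<Rightarrow> 'a set" where
  "target M a [] = {a}"
| "target M a (X # K) = \<Union>(blockers M X)"

text \<open>The layers are forbidden along with the matching: an edge that enters the matching then
  blocks no layer that is kept, so sets of blockers can only shrink.\<close>

definition forbidden :: "'a set set \<Rightarrow> 'a set set list \<Rightarrow> 'a set" where
  "forbidden M K = B \<inter> (\<Union>M \<union> \<Union>(\<Union>(set K)))"

definition swap :: "'a set set \<Rightarrow> 'a set set \<Rightarrow> 'a set set" where
  "swap M I = {f \<in> M. f \<inter> \<Union>I = {}} \<union> I"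

section \<open>Counting in stacks; pushing layers and exchanging edges\<close>

lemma matching_eq: "matching M \<Longrightarrow> f \<in> M \<Longrightarrow> g \<in> M \<Longrightarrow> v \<in> f \<Longrightarrow> v \<in> g \<Longrightarrow> f = g"
  unfolding matching_def pairwise_def disjnt_def by blast

lemma matching_subset: "matching M \<Longrightarrow> M \<subseteq> E"
  unfolding matching_def by blast

lemma finite_matching: "matching M \<Longrightarrow> finite M"
  using matching_subset finite_E finite_subset by blast

lemma blockers_subset: "blockers M X \<subseteq> M"
  unfolding blockers_def by blast

lemma finite_blockers: "matching M \<Longrightarrow> finite (blockers M X)"
  by (rule finite_subset[OF blockers_subset finite_matching])

lemma blockers_Un: "blockers M (X \<union> Z) = blockers M X \<union> blockers M Z"
  unfolding blockers_def by blast

lemma blockers_set: "blockers M (\<Union>(set K)) = (\<Union>X\<in>set K. blockers M X)"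
  unfolding blockers_def by blast

text \<open>\<open>used\<close> contains all vertices that lower blockers have in \<open>B\<close>,
  and the new layer avoids it. This makes \<open>num\<close> additive over the layers.\<close>

lemma layers_blockers_disjoint:
  assumes "layers D M a (X # K)"
  shows "blockers M X \<inter> blockers M (\<Union>(set K)) = {}"
proof -
  have "e \<inter> used M K = {}" if "e \<in> X" for e using assms that by auto
  then show ?thesis unfolding used_def blockers_def by blast
qed

lemma num_Cons:
  assumes "matching M" "layers D M a (X # K)"
  shows "num M (X # K) = num M K + card (blockers M X)"
  using layers_blockers_disjoint[OF assms(2)] finite_blockers[OF assms(1)]
  by (simp add: num_def blockers_Un card_Un_disjoint)

lemma card_matching_le:
  assumes "matching M" "F \<subseteq> M" "finite V" "\<And>f. f \<in> F \<Longrightarrow> f \<inter> V \<noteq> {}"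
  shows "card F \<le> card V"
  by (rule card_pairwise_disjnt_le)
    (use assms in \<open>auto simp: matching_def intro: pairwise_subset\<close>)

lemma card_Union_edges: "X \<subseteq> E \<Longrightarrow> card (\<Union>X) \<le> r * card X"
  by (rule card_Union_le_mult) (use edge_card in auto)

lemma finite_Union_edges: "X \<subseteq> E \<Longrightarrow> finite (\<Union>X)"
  using finite_E edge_finite by (meson finite_Union finite_subset subsetD)

lemma card_A_Union: "X \<subseteq> E \<Longrightarrow> card (A \<inter> \<Union>X) \<le> card X"
proof -
  assume X: "X \<subseteq> E"
  have "card (\<Union>((\<lambda>e. A \<inter> e) ` X)) \<le> 1 * card ((\<lambda>e. A \<inter> e) ` X)"
    by (rule card_Union_le_mult) (use edge_A X in \<open>fastforce simp: Int_commute\<close>)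
  also have "\<dots> \<le> card X" using card_image_le[of X "\<lambda>e. A \<inter> e"] X finite_E finite_subset by auto
  also have "\<Union>((\<lambda>e. A \<inter> e) ` X) = A \<inter> \<Union>X" by blast
  finally show ?thesis .
qed

text \<open>Blockers are disjoint edges with exactly one vertex in \<open>A\<close> each, and the
  uncovered root lies on none of them.\<close>

lemma num_le_reach:
  assumes "matching M" "a \<in> A" "a \<notin> \<Union>M"
  shows "num M K = card (A \<inter> reach M a K)"
proof -
  let ?Y = "blockers M (\<Union>(set K))"
  have Y: "?Y \<subseteq> E" using blockers_subset matching_subset[OF assms(1)] by blast
  have "card ?Y \<le> card (A \<inter> \<Union>?Y)"
    by (rule card_matching_le[OF assms(1) blockers_subset]) (use finite_A Y edge_A in fastforce)+
  then have "card ?Y = card (A \<inter> \<Union>?Y)" using card_A_Union[OF Y] by simp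
  moreover have "A \<inter> reach M a K = insert a (A \<inter> \<Union>?Y)" "a \<notin> \<Union>?Y"
    using assms blockers_subset unfolding reach_def by blast+
  ultimately show ?thesis using finite_A unfolding num_def by simp
qed

lemma num_le_card_A:
  assumes "matching M" "a \<in> A" "a \<notin> \<Union>M"
  shows "num M K \<le> card A"
  unfolding num_le_reach[OF assms] by (rule card_mono) (use finite_A in auto)

text \<open>The part of \<open>reach\<close> inside \<open>B\<close> belongs to \<open>used\<close>,
  so only vertices of \<open>A\<close> remain for the intersection.\<close>

lemma used_avoid_A:
  assumes "matching M" "e \<in> E" "e \<inter> reach M a K \<noteq> {}" "e \<inter> used M K = {}" "a \<in> A"
  shows "e \<inter> (A \<inter> reach M a K) \<noteq> {}"
proof -
  have "e \<inter> reach M a K \<subseteq> A"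
    using assms edge_subset[OF assms(2)] unfolding reach_def used_def by blast
  then show ?thesis using assms(3) by blast
qed

lemma card_layer_le:
  assumes "matching M" "a \<in> A" "a \<notin> \<Union>M" "layers D M a (X # K)"
  shows "card X \<le> num M K"
  unfolding num_le_reach[OF assms(1-3)]
proof (rule card_pairwise_disjnt_le)
  fix e assume "e \<in> X"
  with assms(4) show "e \<inter> (A \<inter> reach M a K) \<noteq> {}"
    by (intro used_avoid_A[OF assms(1) _ _ _ assms(2)]) auto
qed (use assms(4) finite_A in auto)

lemma card_blockers_le:
  assumes "matching M" "X \<subseteq> E"
  shows "card (blockers M X) \<le> r * card X"
proof -
  have "card (blockers M X) \<le> card (\<Union>X)"
    by (rule card_matching_le[OF assms(1) blockers_subset finite_Union_edges[OF assms(2)]])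
      (auto simp: blockers_def)
  then show ?thesis using card_Union_edges[OF assms(2)] by simp
qed

text \<open>The matching enters these notions only through the blockers of the layers.\<close>

lemma layers_cong:
  assumes "\<And>X. X \<in> set K \<Longrightarrow> blockers M' X = blockers M X"
  shows "blockers M' (\<Union>(set K)) = blockers M (\<Union>(set K))" "num M' K = num M K"
    "reach M' a K = reach M a K" "used M' K = used M K" "layers D M' a K = layers D M a K"
proof -
  have b: "blockers M' (\<Union>(set K)) = blockers M (\<Union>(set K))"
    if "\<And>X. X \<in> set K \<Longrightarrow> blockers M' X = blockers M X" for K
    using that unfolding blockers_set by simp
  then show "blockers M' (\<Union>(set K)) = blockers M (\<Union>(set K))" "num M' K = num M K"
    "reach M' a K = reach M a K" "used M' K = used M K"
    using assms unfolding num_def reach_def used_def by auto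
  show "layers D M' a K = layers D M a K"
    using assms
  proof (induction K)
    case (Cons X K)
    then have "num M' K = num M K" "reach M' a K = reach M a K" "used M' K = used M K"
      using b[of K] unfolding num_def reach_def used_def by auto
    with Cons show ?case by auto
  qed simp
qed

lemma layers_push:
  assumes "layers D M a K" "greedy_choice M (reach M a K) (used M K) X" "num M K \<le> D * card X"
  shows "layers D M a (X # K)"
proof -
  have "\<forall>f\<in>blockers M X. \<forall>e\<in>X. \<forall>e'\<in>X. f \<inter> B \<inter> e \<noteq> {} \<longrightarrow> f \<inter> B \<inter> e' \<noteq> {} \<longrightarrow> e = e'"
    (is "\<forall>f\<in>_. ?Q f")
  proof
    fix f assume "f \<in> blockers M X"
    then have f: "f \<in> M" by (simp add: blockers_def)
    have "\<forall>f\<in>M. ?Q f" using assms(2) unfolding greedy_choice_def by (elim conjE)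
    then show "?Q f" using f by (rule bspec)
  qed
  then show ?thesis using assms greedy_choiceD(1-4)[OF assms(2)] by simp
qed

lemma layers_mono: "layers D M a (Z @ K) \<Longrightarrow> layers D M a K"
  by (induction Z) auto

text \<open>The removed edges of the matching are determined by their vertex in \<open>A\<close>: since the new edges
  avoid the matching inside \<open>B\<close>, each of them replaces one edge.\<close>

lemma swap_removed:
  assumes M: "matching M" and I: "greedy_choice M (\<Union>Y) W I" and "Y \<subseteq> M" "B \<inter> \<Union>M \<subseteq> W"
  shows "{f \<in> M. f \<inter> \<Union>I \<noteq> {}} \<subseteq> Y"
    and "card I \<le> card {f \<in> M. f \<inter> \<Union>I \<noteq> {}}"
    and "A \<inter> \<Union>(swap M I) = A \<inter> \<Union>M"
proof -
  let ?F = "{f \<in> M. f \<inter> \<Union>I \<noteq> {}}"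
  have I': "I \<subseteq> E" "pairwise disjnt I" "\<And>e. e \<in> I \<Longrightarrow> e \<inter> \<Union>Y \<noteq> {} \<and> e \<inter> W = {}"
    using I unfolding greedy_choice_def by simp_all
  have IE: "e \<in> E" and IW: "e \<inter> B \<inter> \<Union>M = {}" and IY: "\<exists>g\<in>Y. e \<inter> g \<noteq> {}" if "e \<in> I" for e
    using I'(1) I'(3)[OF that] that assms(4) by blast+
  have dis: "e = e'" if "e \<in> I" "e' \<in> I" "v \<in> e" "v \<in> e'" for e e' v
    using I'(2) that unfolding pairwise_def disjnt_def by blast
  have ME: "f \<in> E" if "f \<in> M" for f using matching_subset[OF M] that by blast
  have in_A: "v \<in> A" if "v \<in> e" "v \<in> f" "e \<in> I" "f \<in> M" for v e f
    using edge_subset[OF IE[OF that(3)]] IW[OF that(3)] that by blast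
  have same: "f = g" if "v \<in> e" "v \<in> f" "w \<in> e" "w \<in> g" "e \<in> I" "f \<in> M" "g \<in> M" for v w e f g
  proof -
    have "v \<in> A" "w \<in> A" using in_A that by blast+
    then have "v = w" using edge_A_eq[OF IE[OF that(5)]] that by blast
    then show ?thesis using matching_eq[OF M] that by blast
  qed
  show "?F \<subseteq> Y"
  proof
    fix f assume "f \<in> ?F"
    then obtain e v where e: "e \<in> I" "v \<in> e" "v \<in> f" "f \<in> M" by blast
    obtain g w where g: "g \<in> Y" "w \<in> e" "w \<in> g" using IY[OF e(1)] by blast
    have "f = g" using same[OF e(2,3) g(2,3) e(1,4)] g(1) assms(3) by blast
    then show "f \<in> Y" using g by simp
  qed
  show "card I \<le> card ?F"
  proof (rule card_le_if_inj_on_rel[where r = "\<lambda>e f. e \<inter> f \<noteq> {}"])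
    show "finite ?F" using finite_matching[OF M] by simp
    show "\<exists>f. f \<in> ?F \<and> e \<inter> f \<noteq> {}" if "e \<in> I" for e
      using IY[OF that] that assms(3) by blast
    fix e e' f assume *: "e \<in> I" "e' \<in> I" "f \<in> ?F" "e \<inter> f \<noteq> {}" "e' \<inter> f \<noteq> {}"
    then obtain v w where v: "v \<in> e" "v \<in> f" "w \<in> e'" "w \<in> f" by blast
    have "v \<in> A" "w \<in> A" using in_A v * by blast+
    then have "v = w" using edge_A_eq[OF ME, of f v w] v * by blast
    then show "e = e'" using dis v * by blast
  qed
  show "A \<inter> \<Union>(swap M I) = A \<inter> \<Union>M"
  proof (intro set_eqI iffI)
    fix v assume v: "v \<in> A \<inter> \<Union>(swap M I)"
    then consider "v \<in> \<Union>M" | e where "e \<in> I" "v \<in> e" unfolding swap_def by blast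
    then show "v \<in> A \<inter> \<Union>M"
    proof cases
      case 2
      obtain g w where g: "g \<in> Y" "w \<in> e" "w \<in> g" using IY[OF 2(1)] by blast
      have "w \<in> A" using in_A[OF g(2,3) 2(1)] g assms(3) by blast
      then have "w = v" using edge_A_eq[OF IE[OF 2(1)], of w v] 2 g v by blast
      then show ?thesis using g assms(3) v by blast
    qed (use v in blast)
  next
    fix v assume v: "v \<in> A \<inter> \<Union>M"
    then obtain f where f: "f \<in> M" "v \<in> f" by blast
    show "v \<in> A \<inter> \<Union>(swap M I)"
    proof (cases "f \<in> ?F")
      case True
      then obtain e w where e: "e \<in> I" "w \<in> e" "w \<in> f" by blast
      have "w \<in> A" using in_A[OF e(2,3,1) f(1)] .
      then have "w = v" using edge_A_eq[OF ME[OF f(1)], of w v] e f v by blast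
      then show ?thesis using e v unfolding swap_def by blast
    qed (use f v in \<open>auto simp: swap_def\<close>)
  qed
qed

lemma matching_swap:
  assumes "matching M" "greedy_choice M S W I"
  shows "matching (swap M I)"
proof -
  have I: "I \<subseteq> E" "pairwise disjnt I" using assms(2) unfolding greedy_choice_def by simp_all
  have M: "M \<subseteq> E" "pairwise disjnt M" using assms(1) unfolding matching_def by simp_all
  have "pairwise disjnt (swap M I)"
    unfolding pairwise_def
  proof (intro ballI impI)
    fix e f assume "e \<in> swap M I" "f \<in> swap M I" "e \<noteq> f"
    then consider "e \<in> M" "f \<in> M" | "e \<in> I" "f \<in> I" | "e \<inter> f = {}"
      unfolding swap_def by blast
    then show "disjnt e f"
      using M(2) I(2) \<open>e \<noteq> f\<close> by cases (auto simp: disjnt_def pairwise_def)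
  qed
  then show ?thesis using I(1) M(1) unfolding matching_def swap_def by blast
qed

text \<open>The exchange removes only blockers of the top layer \<open>X\<close>, which are disjoint
  from the lower blockers, and the new edges block no layer since they avoid all layers inside
  \<open>B\<close>. The size condition \<open>num M K \<le> D * card X\<close> survives because it
  counts layer edges, which are kept even if they lose their blockers.\<close>

lemma swap_layers:
  assumes M: "matching M" and L: "layers D M a (X # K)"
    and I: "greedy_choice M (target M a (X # K)) (forbidden M (X # K)) I"
  shows "layers D (swap M I) a (X # K)"
    and "\<And>Z. Z \<in> set K \<Longrightarrow> blockers (swap M I) Z = blockers M Z"
    and "card (blockers (swap M I) X) + card I \<le> card (blockers M X)"
    and "A \<inter> \<Union>(swap M I) = A \<inter> \<Union>M"
proof -
  let ?F = "{f \<in> M. f \<inter> \<Union>I \<noteq> {}}"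
  note removed = swap_removed[OF M _ blockers_subset, of X "forbidden M (X # K)" I]
  have W: "B \<inter> \<Union>M \<subseteq> forbidden M (X # K)" unfolding forbidden_def by blast
  have F: "?F \<subseteq> blockers M X" "card I \<le> card ?F" "A \<inter> \<Union>(swap M I) = A \<inter> \<Union>M"
    using removed[OF _ W] I by simp_all
  show "A \<inter> \<Union>(swap M I) = A \<inter> \<Union>M" by (rule F(3))
  have new: "e \<inter> B \<inter> \<Union>Z = {}" if "e \<in> I" "Z \<in> set (X # K)" for e Z
    using I that unfolding greedy_choice_def forbidden_def by fastforce
  have b: "blockers (swap M I) Z = blockers M Z - ?F" if "Z \<in> set (X # K)" for Z
    using new[OF _ that] unfolding blockers_def swap_def by blast
  show K: "blockers (swap M I) Z = blockers M Z" if "Z \<in> set K" for Z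
  proof -
    have "blockers M Z \<subseteq> blockers M (\<Union>(set K))" using that unfolding blockers_def by blast
    then have "blockers M Z \<inter> ?F = {}" using F(1) layers_blockers_disjoint[OF L] by blast
    then show ?thesis using b[of Z] that by auto
  qed
  have X: "blockers (swap M I) X = blockers M X - ?F" using b[of X] by simp
  have "card (blockers (swap M I) X) = card (blockers M X) - card ?F"
    unfolding X by (rule card_Diff_subset[OF finite_subset[OF F(1) finite_blockers[OF M]] F(1)])
  moreover have "card ?F \<le> card (blockers M X)"
    by (rule card_mono[OF finite_blockers[OF M] F(1)])
  ultimately show "card (blockers (swap M I) X) + card I \<le> card (blockers M X)"
    using F(2) by linarith
  show "layers D (swap M I) a (X # K)"
    using L layers_cong[OF K, of K] X by (simp, blast)
qed

section \<open>Growth of a stack that admits no exchange\<close>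

fun stuck :: "nat \<Rightarrow> 'a set set \<Rightarrow> 'a \<Rightarrow> 'a set set list \<Rightarrow> bool" where
  "stuck G M a [] \<longleftrightarrow> (\<exists>I. greedy_choice M (target M a []) (forbidden M []) I \<and> G * card I < 1)"
| "stuck G M a (X # K) \<longleftrightarrow> stuck G M a K \<and>
     (\<exists>I. greedy_choice M (target M a (X # K)) (forbidden M (X # K)) I \<and> G * card I < num M K)"

text \<open>Adds up the thresholds in \<open>stuck\<close>. The root contributes 0: for
  \<open>G \<ge> 1\<close>, its threshold forces an empty choice.\<close>

fun total :: "'a set set \<Rightarrow> 'a set set list \<Rightarrow> nat" where
  "total M [] = 0"
| "total M (X # K) = total M K + num M K"

abbreviation unblocked :: "'a set set \<Rightarrow> 'a set set \<Rightarrow> 'a set set" where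
  "unblocked M X \<equiv> {x \<in> X. x \<inter> B \<inter> \<Union>M = {}}"

fun total_unblocked :: "'a set set \<Rightarrow> 'a set set list \<Rightarrow> nat" where
  "total_unblocked M [] = 0"
| "total_unblocked M (X # K) = total_unblocked M K + card (unblocked M X)"

text \<open>Every \<open>x\<close> in \<open>X\<close> meets the target of some level and avoids
  everything forbidden there. By maximality it meets the choice \<open>I\<close> of that level, or
  \<open>I\<close> would allow one more edge. As \<open>X\<close> is disjoint, at most
  \<open>card (\<Union>I) \<le> r * card I\<close> members belong to a level. The statement allows
  arbitrary sets \<open>X\<close> because the induction splits off the members assigned to the top
  level and passes the rest down.\<close>

lemma stuck_unblocked:
  assumes "G \<ge> 1" "stuck G M a K" "X \<subseteq> E" "pairwise disjnt X"
    "\<And>x. x \<in> X \<Longrightarrow> x \<inter> B \<inter> \<Union>M = {}" "\<And>x. x \<in> X \<Longrightarrow> x \<inter> B \<inter> \<Union>(\<Union>(set K)) = {}"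
    "\<And>x. x \<in> X \<Longrightarrow> x \<inter> reach M a K \<noteq> {}"
  shows "G * card X \<le> r * total M K"
  using assms(2-)
proof (induction K arbitrary: X)
  case Nil
  obtain I where I: "greedy_choice M {a} (B \<inter> \<Union>M) I" "G * card I < 1"
    using Nil.prems(1) by (auto simp: forbidden_def)
  have "finite I" by (rule finite_subset[OF greedy_choiceD(1)[OF I(1)] finite_E])
  with I(2) assms(1) have "I = {}" by simp
  have "X = {}"
  proof (rule ccontr)
    assume "X \<noteq> {}"
    then obtain x where x: "x \<in> X" by blast
    have "x \<inter> {a} \<noteq> {}" using Nil.prems(6)[OF x] by (simp add: reach_def blockers_def)
    moreover have "x \<in> E" using x Nil.prems(2) by blast
    ultimately have "x \<inter> ((B \<inter> \<Union>M) \<union> \<Union>I \<union> (B \<inter> \<Union>{f \<in> M. f \<inter> \<Union>I \<noteq> {}})) \<noteq> {}"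
      using greedy_choiceD(5)[OF I(1)] by simp
    then show False using Nil.prems(4)[OF x] \<open>I = {}\<close> by auto
  qed
  then show ?case by simp
next
  case (Cons Z K)
  obtain I where I: "greedy_choice M (\<Union>(blockers M Z)) (forbidden M (Z # K)) I"
    "G * card I < num M K"
    using Cons.prems(1) by auto
  have IE: "I \<subseteq> E" by (rule greedy_choiceD(1)[OF I(1)])
  define X1 where "X1 = {x \<in> X. x \<inter> \<Union>(blockers M Z) \<noteq> {}}"
  have "G * card (X - X1) \<le> r * total M K"
  proof (rule Cons.IH)
    show "x \<inter> reach M a K \<noteq> {}" if "x \<in> X - X1" for x
      using Cons.prems(6)[of x] that by (auto simp: X1_def reach_def blockers_Un)
    show "x \<inter> B \<inter> \<Union>(\<Union>(set K)) = {}" if "x \<in> X - X1" for x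
      using Cons.prems(5)[of x] that by (simp add: Int_Un_distrib)
  qed (use Cons.prems in \<open>auto intro: pairwise_subset\<close>)
  moreover have "card X1 \<le> card (\<Union>I)"
  proof (rule card_pairwise_disjnt_le)
    show "pairwise disjnt X1" using Cons.prems(3) by (rule pairwise_subset) (auto simp: X1_def)
    show "finite (\<Union>I)" by (rule finite_Union_edges[OF IE])
    fix x assume x: "x \<in> X1"
    then have xX: "x \<in> X" unfolding X1_def by blast
    have "x \<in> E" using xX Cons.prems(2) by blast
    moreover have "x \<inter> \<Union>(blockers M Z) \<noteq> {}" using x unfolding X1_def by simp
    ultimately have "x \<inter> (forbidden M (Z # K) \<union> \<Union>I \<union> (B \<inter> \<Union>{f \<in> M. f \<inter> \<Union>I \<noteq> {}})) \<noteq> {}"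
      using greedy_choiceD(5)[OF I(1)] by simp
    moreover have "x \<inter> forbidden M (Z # K) = {}"
      using Cons.prems(4,5)[OF xX] unfolding forbidden_def by blast
    moreover have "x \<inter> (B \<inter> \<Union>{f \<in> M. f \<inter> \<Union>I \<noteq> {}}) = {}"
      using Cons.prems(4)[OF xX] by blast
    ultimately show "x \<inter> \<Union>I \<noteq> {}" by blast
  qed
  then have "card X1 \<le> r * card I" using card_Union_edges[OF IE] by simp
  then have "G * card X1 \<le> r * (G * card I)" by (metis mult.left_commute mult_le_mono2)
  then have "G * card X1 \<le> r * num M K"
    using I(2) by (meson less_imp_le mult_le_mono2 order_trans)
  moreover have "card X = card X1 + card (X - X1)"
  proof -
    have "finite X" by (rule finite_subset[OF Cons.prems(2) finite_E])
    then have "card (X1 \<union> (X - X1)) = card X1 + card (X - X1)"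
      by (intro card_Un_disjoint) (auto simp: X1_def)
    moreover have "X1 \<union> (X - X1) = X" unfolding X1_def by blast
    ultimately show ?thesis by simp
  qed
  ultimately show ?case by (simp add: algebra_simps)
qed

lemma layer_unblocked:
  assumes "G \<ge> 1" "layers D M a (X # K)" "stuck G M a K"
  shows "G * card (unblocked M X) \<le> r * total M K"
proof (rule stuck_unblocked[OF assms(1,3)])
  show "pairwise disjnt (unblocked M X)"
    using assms(2) by (auto intro: pairwise_subset)
  fix x assume "x \<in> unblocked M X"
  then have "x \<in> X" "x \<inter> reach M a K \<noteq> {}" "x \<inter> used M K = {}" "x \<inter> B \<inter> \<Union>M = {}"
    using assms(2) by auto
  then show "x \<inter> B \<inter> \<Union>M = {}" "x \<inter> B \<inter> \<Union>(\<Union>(set K)) = {}" "x \<inter> reach M a K \<noteq> {}"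
    unfolding used_def by blast+
qed (use assms(2) in auto)

text \<open>No matching edge blocks two edges of a layer, so assigning a blocker to each blocked
  layer edge is injective. This is the purpose of letting a greedy selection also forbid the
  matching edges it meets.\<close>

lemma layer_blocked:
  assumes "matching M" "layers D M a (X # K)"
  shows "card X \<le> card (blockers M X) + card (unblocked M X)"
proof -
  have "card (X - unblocked M X) \<le> card (blockers M X)"
  proof (rule card_le_if_inj_on_rel[where r = "\<lambda>e f. f \<inter> B \<inter> e \<noteq> {}"])
    show "finite (blockers M X)" by (rule finite_blockers[OF assms(1)])
    show "\<exists>f. f \<in> blockers M X \<and> f \<inter> B \<inter> e \<noteq> {}" if "e \<in> X - unblocked M X" for e
      using that unfolding blockers_def by blast
    show "e = e'" if "e \<in> X - unblocked M X" "e' \<in> X - unblocked M X" "f \<in> blockers M X"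
      "f \<inter> B \<inter> e \<noteq> {}" "f \<inter> B \<inter> e' \<noteq> {}" for e e' f
      using assms(2) that by auto
  qed
  moreover have "finite X" using assms(2) finite_E finite_subset by auto
  then have "card X = card (unblocked M X) + card (X - unblocked M X)"
    using card_mono[of X "unblocked M X"] by (subst card_Diff_subset) auto
  ultimately show ?thesis by simp
qed

text \<open>At most \<open>num M K / (2 D)\<close> of the at least \<open>num M K / D\<close> edges
  of \<open>X\<close> lack a blocker, so \<open>X\<close> contributes at least
  \<open>num M K / (2 D)\<close> new blockers. The two claims support each other: growth makes
  \<open>total\<close> a geometric sum, and the bound on \<open>total\<close> limits the unblocked
  edges of the next layer.\<close>

lemma growth:
  assumes "matching M" "r * (4 * D ^ 2) \<le> G" "D \<ge> 1"
  shows "layers D M a K \<Longrightarrow> stuck G M a K \<Longrightarrow> total M K \<le> 2 * D * num M K"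
    and "layers D M a (X # K) \<Longrightarrow> stuck G M a K \<Longrightarrow>
      (2 * D + 1) * num M K \<le> 2 * D * num M (X # K)"
proof -
  have G: "G \<ge> 1"
  proof -
    have "1 * (4 * 1) \<le> r * (4 * D ^ 2)" using assms(3) r2 by (intro mult_le_mono) auto
    then show ?thesis using assms(2) by linarith
  qed
  have step: "(2 * D + 1) * num M K \<le> 2 * D * num M (X # K)"
    if L: "layers D M a (X # K)" and s: "stuck G M a K" and t: "total M K \<le> 2 * D * num M K"
    for X K
  proof -
    let ?u = "card (unblocked M X)"
    have "(2 * D * r) * (2 * D * ?u) = r * (4 * D ^ 2) * ?u" by (simp add: power2_eq_square)
    also have "\<dots> \<le> G * ?u" using assms(2) by (rule mult_le_mono1)
    also have "\<dots> \<le> r * total M K" by (rule layer_unblocked[OF G L s])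
    also have "\<dots> \<le> r * (2 * D * num M K)" using t by (rule mult_le_mono2)
    also have "\<dots> = (2 * D * r) * num M K" by simp
    finally have "2 * D * ?u \<le> num M K" using assms(3) r2 by simp
    moreover have "2 * D * card X \<le> 2 * D * card (blockers M X) + 2 * D * ?u"
      using mult_le_mono2[OF layer_blocked[OF assms(1) L], of "2 * D"] by (simp add: distrib_left)
    moreover have "num M K \<le> D * card X" using L by simp
    ultimately show ?thesis unfolding num_Cons[OF assms(1) L] by (simp add: algebra_simps)
  qed
  show tot: "layers D M a K \<Longrightarrow> stuck G M a K \<Longrightarrow> total M K \<le> 2 * D * num M K" for K
  proof (induction K)
    case (Cons X K)
    then show ?case using step[of X K] by (simp add: algebra_simps)
  qed simp
  show "layers D M a (X # K) \<Longrightarrow> stuck G M a K \<Longrightarrow>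
      (2 * D + 1) * num M K \<le> 2 * D * num M (X # K)"
    using step tot by auto
qed

lemma num_ge_power:
  assumes "matching M" "r * (4 * D ^ 2) \<le> G" "D \<ge> 1" "layers D M a K" "stuck G M a K"
  shows "(1 + 1 / (2 * real D)) ^ length K \<le> real (num M K)"
  using assms(4,5)
proof (induction K)
  case Nil
  then show ?case by (simp add: num_def)
next
  case (Cons X K)
  have D: "real D > 0" using assms(3) by simp
  have "(2 * D + 1) * num M K \<le> 2 * D * num M (X # K)"
    using growth(2)[OF assms(1-3)] Cons.prems by auto
  then have "real ((2 * D + 1) * num M K) \<le> real (2 * D * num M (X # K))" by (simp only: of_nat_le_iff)
  then have "(1 + 1 / (2 * real D)) * real (num M K) \<le> real (num M (X # K))"
    using D by (simp add: field_simps)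
  moreover have "(1 + 1 / (2 * real D)) * (1 + 1 / (2 * real D)) ^ length K
      \<le> (1 + 1 / (2 * real D)) * real (num M K)"
    using Cons by (intro mult_left_mono) auto
  ultimately show ?case by simp
qed

text \<open>\<open>G\<close> has one factor \<open>D\<close> more than in \<open>growth\<close>:
  summing \<open>card (unblocked M X)\<close> over the layers turns each \<open>num M K\<close> into
  \<open>total\<close>, which costs another factor \<open>2 D\<close>, and a saving of
  \<open>D\<close> has to remain.\<close>

lemma total_unblocked_le:
  assumes "matching M" "r * (4 * D ^ 3) \<le> G" "D \<ge> 1" "layers D M a K" "stuck G M a K"
  shows "D * total_unblocked M K \<le> num M K"
proof -
  have "D ^ 2 \<le> D ^ 3" using assms(3) by (intro power_increasing) auto
  then have G2: "r * (4 * D ^ 2) \<le> G"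
    using assms(2) by (meson mult_le_mono2 order_trans)
  have "1 * (4 * 1) \<le> r * (4 * D ^ 2)" using assms(3) r2 by (intro mult_le_mono) auto
  then have G: "G \<ge> 1" using G2 by linarith
  note tot = growth(1)[OF assms(1) G2 assms(3)]
  have "G * total_unblocked M K \<le> r * 2 * D * total M K"
    using assms(4,5)
  proof (induction K)
    case (Cons X K)
    have "G * card (unblocked M X) \<le> r * total M K"
      using layer_unblocked[OF G Cons.prems(1)] Cons.prems(2) by simp
    also have "\<dots> \<le> r * (2 * D * num M K)"
      using tot Cons.prems by (intro mult_le_mono2) auto
    finally show ?case using Cons by (simp add: algebra_simps)
  qed simp
  also have "\<dots> \<le> r * 2 * D * (2 * D * num M K)"
    using tot assms(4,5) by (intro mult_le_mono2) auto
  finally have "G * total_unblocked M K \<le> r * 2 * D * (2 * D * num M K)" .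
  then have "r * (4 * D ^ 3) * total_unblocked M K \<le> r * 2 * D * (2 * D * num M K)"
    using mult_le_mono1[OF assms(2), of "total_unblocked M K"] by linarith
  then have "(4 * r * D ^ 2) * (D * total_unblocked M K) \<le> (4 * r * D ^ 2) * num M K"
    by (simp add: power2_eq_square power3_eq_cube algebra_simps)
  then show ?thesis using assms(3) r2 by simp
qed


subsection \<open>The hitting set of a stack that cannot be extended\<close>

fun layer_sizes :: "'a set set list \<Rightarrow> nat" where
  "layer_sizes [] = 0"
| "layer_sizes (X # K) = layer_sizes K + card X"

lemma layer_sizes_le:
  assumes "matching M" "layers D M a K"
  shows "layer_sizes K + 1 \<le> num M K + total_unblocked M K"
  using assms(2)
proof (induction K)
  case (Cons X K)
  then show ?case
    using layer_blocked[OF assms(1) Cons.prems] num_Cons[OF assms(1) Cons.prems] by simp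
qed (simp add: num_def)

lemma card_B_layers:
  assumes "layers D M a K"
  shows "card (B \<inter> \<Union>(\<Union>(set K))) \<le> (r - 1) * layer_sizes K"
  using assms
proof (induction K)
  case (Cons X K)
  have X: "X \<subseteq> E" using Cons.prems by simp
  have "card (\<Union>((\<lambda>e. e \<inter> B) ` X)) \<le> (r - 1) * card ((\<lambda>e. e \<inter> B) ` X)"
    by (rule card_Union_le_mult) (use X edge_card_B in auto)
  also have "\<dots> \<le> (r - 1) * card X"
    using finite_subset[OF X finite_E] by (intro mult_le_mono2 card_image_le)
  finally have "card (B \<inter> \<Union>X) \<le> (r - 1) * card X" by (simp add: Int_commute)
  moreover have "card (B \<inter> \<Union>(\<Union>(set (X # K)))) \<le> card (B \<inter> \<Union>X) + card (B \<inter> \<Union>(\<Union>(set K)))"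
    using card_Un_le[of "B \<inter> \<Union>X" "B \<inter> \<Union>(\<Union>(set K))"] by (simp add: Int_Un_distrib)
  ultimately show ?case using Cons by (simp add: distrib_left)
qed simp

text \<open>A layer edge has \<open>r - 1\<close> vertices in \<open>B\<close>; a blocker has one of
  its own \<open>r - 1\<close> on some layer edge and adds at most \<open>r - 2\<close>. There are
  \<open>num M K - 1\<close> blockers.\<close>

lemma card_used:
  assumes "matching M" "layers D M a K"
  shows "card (used M K) \<le> (r - 1) * layer_sizes K + (r - 2) * (num M K - 1)"
proof -
  let ?U = "\<Union>(\<Union>(set K))" and ?Y = "blockers M (\<Union>(set K))"
  have Y: "?Y \<subseteq> E" using blockers_subset matching_subset[OF assms(1)] by blast
  have "card (\<Union>((\<lambda>f. f \<inter> B - ?U) ` ?Y)) \<le> (r - 2) * card ((\<lambda>f. f \<inter> B - ?U) ` ?Y)"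
  proof (rule card_Union_le_mult)
    fix g assume "g \<in> (\<lambda>f. f \<inter> B - ?U) ` ?Y"
    then obtain f where f: "f \<in> ?Y" "g = f \<inter> B - ?U" by blast
    then have "f \<inter> B - ?U \<subset> f \<inter> B" unfolding blockers_def by blast
    then have "card (f \<inter> B - ?U) < card (f \<inter> B)"
      using finite_B by (intro psubset_card_mono) auto
    then show "card g \<le> r - 2" using edge_card_B[of f] f Y by auto
  qed
  also have "\<dots> \<le> (r - 2) * card ?Y"
    using finite_blockers[OF assms(1)] by (intro mult_le_mono2 card_image_le)
  finally have 1: "card (\<Union>((\<lambda>f. f \<inter> B - ?U) ` ?Y)) \<le> (r - 2) * card ?Y" .
  have "used M K = (B \<inter> ?U) \<union> \<Union>((\<lambda>f. f \<inter> B - ?U) ` ?Y)" unfolding used_def by blast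
  then have "card (used M K) \<le> card (B \<inter> ?U) + card (\<Union>((\<lambda>f. f \<inter> B - ?U) ` ?Y))"
    by (metis card_Un_le)
  then show ?thesis using 1 card_B_layers[OF assms(2)] by (simp add: num_def)
qed

text \<open>By maximality of the last selection \<open>X\<close>, an edge at a reached vertex meets
  the vertices in use, \<open>X\<close>, or the matching edges that \<open>X\<close> meets. Vertices
  of \<open>A\<close> on \<open>X\<close> are taken out of \<open>S\<close> so that this
  intersection lies in \<open>B\<close>: the only vertex of the edge in \<open>A\<close> is then not
  on \<open>X\<close>.\<close>

lemma certificate:
  fixes \<epsilon> :: real
  assumes M: "matching M" and a: "a \<in> A" "a \<notin> \<Union>M" and L: "layers D M a K" "stuck G M a K"
    and X: "greedy_choice M (reach M a K) (used M K) X" "D * card X < num M K"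
    and G: "r * (4 * D ^ 3) \<le> G" and eps: "\<epsilon> > 0"
    and D: "2 * (real r ^ 2 + 4 * real r + \<epsilon>) \<le> real D * \<epsilon>"
  defines "S \<equiv> (A \<inter> reach M a K) - \<Union>X"
  shows "\<exists>R\<subseteq>B. hits R (edges_at E S) \<and> real (card R) \<le> (2 * real r - 3 + \<epsilon>) * (real (card S) - 1)"
proof -
  note XD = greedy_choiceD[OF X(1)]
  let ?F = "{f \<in> M. f \<inter> \<Union>X \<noteq> {}}"
  define R where "R = B \<inter> (used M K \<union> \<Union>X \<union> (B \<inter> \<Union>?F))"
  have "2 * \<epsilon> \<le> real D * \<epsilon>"
    using D eps by (smt (verit) mult_nonneg_nonneg of_nat_0_le_iff zero_le_power2)
  then have "real D \<ge> 2" using eps by simp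
  then have D2: "D \<ge> 2" by simp
  have hit: "hits R (edges_at E S)"
    unfolding hits_def
  proof
    fix e assume "e \<in> edges_at E S"
    then have e: "e \<in> E" "e \<inter> S \<noteq> {}" unfolding edges_at_def by auto
    then obtain v where v: "v \<in> e" "v \<in> A" "v \<in> reach M a K" "v \<notin> \<Union>X" unfolding S_def by blast
    have "e \<inter> (used M K \<union> \<Union>X \<union> (B \<inter> \<Union>?F)) \<noteq> {}"
      by (rule XD(5)[OF e(1)]) (use v in blast)
    then obtain w where w: "w \<in> e" "w \<in> used M K \<union> \<Union>X \<union> (B \<inter> \<Union>?F)" by blast
    have "w \<in> B"
    proof (rule ccontr)
      assume "w \<notin> B"
      then have "w \<in> A" "w \<in> \<Union>X" using w edge_subset[OF e(1)] unfolding used_def by blast+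
      then show False using edge_A_eq[OF e(1) v(1,2) w(1)] v(4) by simp
    qed
    then show "R \<inter> e \<noteq> {}" using w unfolding R_def by blast
  qed
  define x u y where "x = card X" and "u = total_unblocked M K" and "y = num M K - 1"
  have N: "num M K = y + 1" unfolding y_def num_def by simp
  have Du: "D * u \<le> y + 1"
    unfolding u_def N[symmetric] by (rule total_unblocked_le[OF M G _ L]) (use D2 in simp)
  have Dx: "D * x < y + 1" using X(2) N x_def by simp
  have cX: "card (\<Union>X) \<le> r * x" using card_Union_edges[OF XD(1)] x_def by simp
  have finX: "finite (\<Union>X)" by (rule finite_Union_edges[OF XD(1)])
  have "card ?F \<le> card (\<Union>X)" by (rule card_matching_le[OF M _ finX]) auto
  then have "card ?F \<le> r * x" using cX by simp
  moreover have FE: "?F \<subseteq> E" using matching_subset[OF M] by blast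
  ultimately have cF: "card (\<Union>?F) \<le> r * (r * x)"
    using order_trans[OF card_Union_edges[OF FE] mult_le_mono2] by blast
  have "card R \<le> card (used M K \<union> (\<Union>X \<union> \<Union>?F))"
    unfolding R_def using finX finite_Union_edges[OF FE] finite_B
    by (intro card_mono) (auto simp: used_def)
  also have "\<dots> \<le> card (used M K) + (card (\<Union>X) + card (\<Union>?F))"
    by (meson add_left_mono card_Un_le order_trans)
  also have "\<dots> \<le> ((r - 1) * layer_sizes K + (r - 2) * y) + (r * x + r * (r * x))"
    using card_used[OF M L(1)] cX cF unfolding y_def by (intro add_mono) auto
  also have "\<dots> \<le> ((r - 1) * (y + u) + (r - 2) * y) + (r * x + r * (r * x))"
    using layer_sizes_le[OF M L(1)] N u_def by simp
  finally have "real (card R) \<le> real (((r - 1) * (y + u) + (r - 2) * y) + (r * x + r * (r * x)))"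
    by (simp only: of_nat_le_iff)
  then have cR: "real (card R) \<le> (2 * real r - 3) * y + (real r - 1) * u + (real r + real r ^ 2) * x"
  proof -
    have "real (((r - 1) * (y + u) + (r - 2) * y) + (r * x + r * (r * x)))
        = (real r - 1) * (y + u) + (real r - 2) * y + (r * x + r * (r * x))"
      using r2 by (simp add: of_nat_diff)
    also have "\<dots> = (2 * real r - 3) * y + (real r - 1) * u + (real r + real r ^ 2) * x"
      by (simp add: algebra_simps power2_eq_square)
    finally show ?thesis using \<open>real (card R) \<le> _\<close> by linarith
  qed
  have "card (A \<inter> reach M a K) - card (A \<inter> \<Union>X) \<le> card S"
  proof -
    have "S = A \<inter> reach M a K - A \<inter> \<Union>X" unfolding S_def by blast
    then show ?thesis using finite_A by (auto intro: diff_card_le_card_Diff)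
  qed
  then have cS: "y + 1 \<le> card S + x"
    using card_A_Union[OF XD(1)] num_le_reach[OF M a, of K] N x_def by linarith
  have "real (card R) \<le> (2 * real r - 3 + \<epsilon>) * (real y - real x)"
  proof (cases "y = 0")
    case True
    \<comment> \<open>With no blockers there is nothing proportional to \<open>y\<close> that could
      absorb an error; \<open>D \<ge> 2\<close> makes \<open>u\<close> and \<open>x\<close> vanish
      instead.\<close>
    have zero: "k = 0" if "D * k \<le> 1" for k
    proof (rule ccontr)
      assume "k \<noteq> 0"
      then have "D * 1 \<le> D * k" by (intro mult_le_mono2) simp
      then show False using that D2 by linarith
    qed
    have "D * u \<le> 1" "D * x \<le> 1" using Du Dx True by linarith+
    then have "u = 0" "x = 0" by (blast intro: zero)+
    then show ?thesis using cR True by simp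
  next
    case False
    then have y: "real y + 1 \<le> 2 * real y" by simp
    have "real (D * u) \<le> real (y + 1)" using Du by (simp only: of_nat_le_iff)
    then have u: "D * real u \<le> 2 * real y" using y by simp
    have "real (D * x) \<le> real (y + 1)" using Dx by (simp only: of_nat_le_iff)
    then have x: "D * real x \<le> 2 * real y" using y by simp
    \<comment> \<open>The last summand pays for replacing \<open>y\<close> by \<open>y - x\<close>.
      Since \<open>D * u\<close> and \<open>D * x\<close> are at most \<open>2 * y\<close>, the
      error coefficients add up to \<open>2 * (r^2 + 4 * r - 4 + \<epsilon>)\<close>, the origin of
      the hypothesis \<open>D\<close>.\<close>
    have "D * ((real r - 1) * u + (real r + real r ^ 2) * x + (2 * real r - 3 + \<epsilon>) * x)
        = (real r - 1) * (D * u) + (real r + real r ^ 2 + (2 * real r - 3 + \<epsilon>)) * (D * x)"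
      by (simp add: algebra_simps)
    also have "\<dots> \<le> (real r - 1) * (2 * y) + (real r + real r ^ 2 + (2 * real r - 3 + \<epsilon>)) * (2 * y)"
    proof (intro add_mono mult_left_mono)
      show "0 \<le> real r + real r ^ 2 + (2 * real r - 3 + \<epsilon>)"
        using r2 eps zero_le_power2[of "real r"] by linarith
    qed (use u x r2 in auto)
    also have "\<dots> = (2 * (real r ^ 2 + 4 * real r - 4 + \<epsilon>)) * y"
      by (simp add: algebra_simps)
    also have "\<dots> \<le> (D * \<epsilon>) * y" using D by (intro mult_right_mono) auto
    finally have "real D * ((real r - 1) * u + (real r + real r ^ 2) * x + (2 * real r - 3 + \<epsilon>) * x)
        \<le> real D * (\<epsilon> * y)" by simp
    then have "(real r - 1) * u + (real r + real r ^ 2) * x + (2 * real r - 3 + \<epsilon>) * x \<le> \<epsilon> * y"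
      using D2 by simp
    then show ?thesis using cR by (simp add: algebra_simps)
  qed
  also have "\<dots> \<le> (2 * real r - 3 + \<epsilon>) * (real (card S) - 1)"
    using cS r2 eps by (intro mult_left_mono) auto
  finally show ?thesis using hit unfolding R_def by blast
qed

subsection \<open>The potential\<close>

context
  fixes G :: nat
  assumes G1: "G \<ge> 1"
begin

text \<open>Chosen so that \<open>base / (2 * G) = r + 1 / G\<close>: the share \<open>r\<close>
  pays for the blockers of a new layer, and \<open>1 / G\<close> is left for the next reserve and
  the decrease.\<close>

definition base :: real where
  "base = 2 * real G * real r + 2"

lemma base_pos: "base > 0"
  unfolding base_def by (simp add: add_nonneg_pos)

text \<open>A change at some level of the stack outweighs everything that may happen above it.\<close>

fun layer_potential :: "'a set set \<Rightarrow> 'a set set list \<Rightarrow> real" where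
  "layer_potential M [] = 0"
| "layer_potential M (X # K) = layer_potential M K
     + real (card (blockers M X)) / real (num M K) / base ^ (length K + 1)"

text \<open>The first summand pays for restarting at a new root. The last one is a reserve consumed
  by the next push, which would otherwise not decrease the value.\<close>

definition potential :: "'a set set \<Rightarrow> 'a set set list \<Rightarrow> real" where
  "potential M K = real (card (A - \<Union>M)) + layer_potential M K + 1 / (2 * real G * base ^ length K)"

lemma num_pos: "real (num M K) > 0"
  unfolding num_def by simp

lemma layer_potential_append: "layer_potential M K \<le> layer_potential M (Z @ K)"
proof (induction Z)
  case (Cons X Z)
  have "0 \<le> real (card (blockers M X)) / real (num M (Z @ K)) / base ^ (length (Z @ K) + 1)"
    using base_pos by simp
  then show ?case using Cons by simp
qed simp

lemma potential_nonneg: "potential M K \<ge> 0"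
proof -
  have "layer_potential M K \<ge> 0" using layer_potential_append[of M "[]" K] by simp
  then show ?thesis using base_pos unfolding potential_def by simp
qed

text \<open>The new layer has at most \<open>r * num M K\<close> blockers, so its term is at most
  \<open>r * w\<close>, while the reserve falls from \<open>r * w + w / G\<close> to
  \<open>w / (2 * G)\<close>.\<close>

lemma potential_push:
  assumes "matching M" "a \<in> A" "a \<notin> \<Union>M" "layers D M a (X # K)"
  shows "potential M (X # K) \<le> potential M K - 1 / (2 * real G * base ^ (length (X # K)))"
proof -
  define w where "w = 1 / base ^ (length K + 1)"
  have w: "w > 0" using base_pos unfolding w_def by simp
  have "card (blockers M X) \<le> r * num M K"
    using card_blockers_le[OF assms(1), of X] card_layer_le[OF assms] assms(4)
    by (auto intro: order_trans mult_le_mono2)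
  then have "real (card (blockers M X)) \<le> real (r * num M K)" by (simp only: of_nat_le_iff)
  then have "real (card (blockers M X)) / real (num M K) \<le> real r"
    using num_pos by (simp add: divide_le_eq)
  then have "real (card (blockers M X)) / real (num M K) * w \<le> real r * w"
    using w by (intro mult_right_mono) auto
  then have 1: "layer_potential M (X # K) \<le> layer_potential M K + real r * w"
    unfolding w_def by simp
  have 2: "1 / (2 * real G * base ^ length K) = w * base / (2 * G)"
    using base_pos by (simp add: w_def)
  have "w * base / (2 * G) = w * r + w / G"
    using G1 by (simp add: base_def field_simps)
  then have 3: "w * base / (2 * G) = real r * w + 2 * (w / (2 * G))" by simp
  have 4: "1 / (2 * real G * base ^ length (X # K)) = w / (2 * G)" by (simp add: w_def)
  show ?thesis using 1 3 unfolding potential_def 2 4 by linarith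
qed

text \<open>The loss of at least \<open>num M K / G\<close> blockers lowers the term of
  \<open>X\<close> by \<open>w / G\<close>. Half of this covers the reserve, which is larger for the
  shorter stack; dropping \<open>Z\<close> costs nothing.\<close>

lemma potential_swap_layer:
  assumes M: "matching M" and L: "layers D M a (X # K)"
    and I: "greedy_choice M (target M a (X # K)) (forbidden M (X # K)) I" "num M K \<le> G * card I"
  shows "potential (swap M I) (X # K)
    \<le> potential M (Z @ X # K) - 1 / (2 * real G * base ^ (length (X # K)))"
proof -
  note sw = swap_layers[OF M L I(1)]
  define w where "w = 1 / base ^ (length K + 1)"
  have w: "w > 0" using base_pos unfolding w_def by simp
  have num: "num (swap M I) K = num M K" by (rule layers_cong(2)[OF sw(2)])
  have "layer_potential (swap M I) Z = layer_potential M Z" if "set Z \<subseteq> set K" for Z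
    using that
  proof (induction Z)
    case (Cons Y Z)
    have "num (swap M I) Z = num M Z" by (rule layers_cong(2)) (use sw(2) Cons.prems in auto)
    then show ?case using Cons sw(2) by simp
  qed simp
  then have pot: "layer_potential (swap M I) K = layer_potential M K" by simp
  have level: "layer_potential M' (X # K)
      = layer_potential M' K + real (card (blockers M' X)) / real (num M' K) * w" for M'
    by (simp add: w_def)
  have "real (card (blockers (swap M I) X) + card I) \<le> real (card (blockers M X))"
    using sw(3) by (simp only: of_nat_le_iff)
  then have "real (card (blockers (swap M I) X)) / num M K + real (card I) / num M K
      \<le> real (card (blockers M X)) / num M K"
    using num_pos[of M K] by (simp add: divide_right_mono flip: add_divide_distrib)
  moreover have "1 / G \<le> real (card I) / num M K"
  proof -
    have "real (num M K) \<le> real (G * card I)" using I(2) by (simp only: of_nat_le_iff)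
    then show ?thesis using num_pos[of M K] G1 by (simp add: field_simps)
  qed
  ultimately have "(real (card (blockers (swap M I) X)) / num M K + 1 / G) * w
      \<le> real (card (blockers M X)) / num M K * w"
    using w by (intro mult_right_mono) auto
  then have 1: "layer_potential (swap M I) (X # K) + w / G \<le> layer_potential M (X # K)"
    unfolding level pot num by (simp add: distrib_right)
  have 2: "layer_potential M (X # K) \<le> layer_potential M (Z @ X # K)"
    by (rule layer_potential_append)
  have "A - \<Union>(swap M I) = A - \<Union>M" using sw(4) by blast
  then have 3: "card (A - \<Union>(swap M I)) = card (A - \<Union>M)" by simp
  have 4: "1 / (2 * real G * base ^ length (X # K)) = w / (2 * G)" by (simp add: w_def)
  have 5: "0 \<le> 1 / (2 * real G * base ^ length (Z @ X # K))" using base_pos by simp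
  have 6: "w / G = 2 * (w / (2 * G))" by simp
  show ?thesis using 1 2 5 6 unfolding potential_def 3 4 by linarith
qed

text \<open>An edge at the uncovered root that avoids the matching inside \<open>B\<close> is
  disjoint from the whole matching. Nothing is removed, one more vertex is covered, and the gain of
  1 outweighs the reserve \<open>1 / (2 * G)\<close> of the empty stack.\<close>

lemma swap_root:
  assumes M: "matching M" and a: "a \<in> A" "a \<notin> \<Union>M"
    and I: "greedy_choice M (target M a []) (forbidden M []) I" "1 \<le> G * card I"
  shows "potential (swap M I) [] \<le> potential M K - 1 / (2 * real G)"
proof -
  note ID = greedy_choiceD[OF I(1)]
  have "I \<noteq> {}" using I(2) by auto
  then obtain e where e: "e \<in> I" "a \<in> e" using ID(3) by auto
  have "\<Union>M \<subseteq> \<Union>(swap M I)"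
  proof -
    have "f \<inter> d = {}" if "f \<in> M" "d \<in> I" for f d
    proof -
      have d: "d \<in> E" "a \<in> d" "d \<inter> (B \<inter> \<Union>M) = {}"
        using ID(1,3,4) that by (auto simp: forbidden_def)
      have "v = a" if "v \<in> f" "v \<in> d" for v
        using edge_subset[OF d(1)] edge_A_eq[OF d(1), of v a] a d that \<open>f \<in> M\<close> by blast
      then show ?thesis using a(2) that(1) by blast
    qed
    then show ?thesis unfolding swap_def by blast
  qed
  then have "A - \<Union>(swap M I) \<subseteq> (A - \<Union>M) - {a}" using e unfolding swap_def by blast
  then have "card (A - \<Union>(swap M I)) \<le> card ((A - \<Union>M) - {a})"
    using finite_A by (intro card_mono) auto
  moreover have "card (A - \<Union>M) > 0" using a finite_A by (auto simp: card_gt_0_iff)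
  ultimately have "card (A - \<Union>(swap M I)) + 1 \<le> card (A - \<Union>M)"
    using a finite_A by simp
  then have 1: "real (card (A - \<Union>(swap M I))) + 1 \<le> real (card (A - \<Union>M))" by linarith
  have 2: "0 \<le> layer_potential M K" using layer_potential_append[of M "[]" K] by simp
  have 3: "0 \<le> 1 / (2 * real G * base ^ length K)" using base_pos by simp
  have 4: "1 / (2 * real G) \<le> 1 / 2" using G1 by (simp add: field_simps)
  have "potential (swap M I) [] = real (card (A - \<Union>(swap M I))) + 1 / (2 * real G)"
    by (simp add: potential_def)
  then show ?thesis using 1 2 3 4 unfolding potential_def by linarith
qed

end

end

section \<open>The algorithm\<close>

definition meets :: "tree \<Rightarrow> tree list \<Rightarrow> bool" where
  "meets e W \<longleftrightarrow> (\<exists>v\<in>set (els e). v \<in> set W)"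

definition restrict :: "tree list \<Rightarrow> tree list \<Rightarrow> tree list" where
  "restrict b W = filter (\<lambda>v. v \<in> set b) W"

definition touching :: "tree list \<Rightarrow> tree list \<Rightarrow> tree list" where
  "touching M W = filter (\<lambda>f. meets f W) M"

definition blocking :: "tree list \<Rightarrow> tree list \<Rightarrow> tree list \<Rightarrow> tree list" where
  "blocking b M X = touching M (restrict b (cat X))"

definition greedy :: "tree list \<Rightarrow> tree list \<Rightarrow> tree list \<Rightarrow> tree list \<Rightarrow> tree list \<Rightarrow> tree list" where
  "greedy b E M S W = foldl (\<lambda>X e.
     if meets e S \<and> \<not> meets e (W @ cat X @ restrict b (cat (touching M (cat X)))) then e # X else X) [] E"

definition number :: "tree list \<Rightarrow> tree list \<Rightarrow> tree \<Rightarrow> nat" where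
  "number b M k = 1 + length (blocking b M (cat (els k)))"

definition choice :: "tree list \<Rightarrow> tree list \<Rightarrow> tree list \<Rightarrow> tree \<Rightarrow> tree \<Rightarrow> tree list" where
  "choice b E M v k = greedy b E M
     (if k = Leaf then [v] else cat (blocking b M (els (hd_tree k))))
     (restrict b (cat M @ cat (cat (els k))))"

text \<open>At the root \<open>tl_tree Leaf = Leaf\<close> and \<open>number\<close> is 1, so for
  \<open>G \<ge> 1\<close> the test asks for a nonempty choice.\<close>

definition collapsible :: "nat \<Rightarrow> tree list \<Rightarrow> tree list \<Rightarrow> tree list \<Rightarrow> tree \<Rightarrow> tree \<Rightarrow> bool" where
  "collapsible G b E M v k \<longleftrightarrow> number b M (tl_tree k) \<le> G * length (choice b E M v k)"

text \<open>The list \<open>els k\<close> is only a counter: its length suffices to descend to the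
  topmost collapsible part or to \<open>Leaf\<close>. A result that is not collapsible means that no
  level is.\<close>

definition scan :: "nat \<Rightarrow> tree list \<Rightarrow> tree list \<Rightarrow> tree list \<Rightarrow> tree \<Rightarrow> tree \<Rightarrow> tree" where
  "scan G b E M v k = foldl (\<lambda>s x. if collapsible G b E M v s then s else tl_tree s) k (els k)"

definition reachable :: "tree list \<Rightarrow> tree list \<Rightarrow> tree \<Rightarrow> tree \<Rightarrow> tree list" where
  "reachable b M v k = v # cat (blocking b M (cat (els k)))"

definition extension :: "tree list \<Rightarrow> tree list \<Rightarrow> tree list \<Rightarrow> tree \<Rightarrow> tree \<Rightarrow> tree list" where
  "extension b E M v k = greedy b E M (reachable b M v k)
     (restrict b (cat (cat (els k)) @ cat (blocking b M (cat (els k)))))"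

definition collapse :: "tree list \<Rightarrow> tree list \<Rightarrow> tree list \<Rightarrow> tree \<Rightarrow> tree \<Rightarrow> tree" where
  "collapse b E M v j =
     Node (tree_of_list (filter (\<lambda>f. \<not> meets f (cat (choice b E M v j))) M @ choice b E M v j)) j"

abbreviation T :: tree where "T \<equiv> Node Leaf Leaf"

definition extend :: "nat \<Rightarrow> tree list \<Rightarrow> tree list \<Rightarrow> tree list \<Rightarrow> tree list \<Rightarrow> tree \<Rightarrow> tree \<Rightarrow> tree" where
  "extend D a b E M v k =
     (if number b M k \<le> D * length (extension b E M v k)
      then Node Leaf (Node (tree_of_list M) (Node (tree_of_list (extension b E M v k)) k))
      else Node T (Node T (tree_of_list
        (filter (\<lambda>x. x \<in> set (reachable b M v k) \<and> \<not> x \<in> set (cat (extension b E M v k))) a))))"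

definition advance :: "nat \<Rightarrow> nat \<Rightarrow> tree list \<Rightarrow> tree list \<Rightarrow> tree list \<Rightarrow> tree list \<Rightarrow> tree \<Rightarrow> tree \<Rightarrow> tree" where
  "advance G D a b E M v k =
     (if collapsible G b E M v (scan G b E M v k)
      then Node Leaf (collapse b E M v (scan G b E M v k)) else extend D a b E M v k)"

definition uncovered :: "tree list \<Rightarrow> tree list \<Rightarrow> tree list" where
  "uncovered a M = filter (\<lambda>v. \<not> v \<in> set (cat M)) a"

text \<open>A state is either \<open>Node Leaf (Node m k)\<close> with a matching \<open>m\<close> and a stack \<open>k\<close> of layers,
  or \<open>Node T u\<close> with the final output \<open>u\<close>.\<close>

definition step :: "nat \<Rightarrow> nat \<Rightarrow> tree list \<Rightarrow> tree list \<Rightarrow> tree list \<Rightarrow> tree \<Rightarrow> tree" where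
  "step G D a b E s =
     (if hd_tree s = Leaf then
        if uncovered a (els (hd_tree (tl_tree s))) = [] then Node T (Node Leaf (hd_tree (tl_tree s)))
        else advance G D a b E (els (hd_tree (tl_tree s)))
          (hd_tree (tree_of_list (uncovered a (els (hd_tree (tl_tree s)))))) (tl_tree (tl_tree s))
      else s)"

definition iterations :: "nat \<Rightarrow> nat \<Rightarrow> tree list \<Rightarrow> nat" where
  "iterations c p a = c * (length a + 2) ^ p"

text \<open>The initial \<open>T\<close> is the pair of an empty matching and an empty stack. The
  number of rounds is fixed in advance to fit \<open>ptime_foldl\<close>; a final state is left
  unchanged by \<open>step\<close>.\<close>

definition find_matching :: "nat \<Rightarrow> nat \<Rightarrow> nat \<Rightarrow> nat \<Rightarrow> tree \<Rightarrow> tree" where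
  "find_matching G D c p t = tl_tree (foldl
     (\<lambda>s x. step G D (els (hd_tree t)) (els (hd_tree (tl_tree t))) (els (tl_tree (tl_tree t))) s)
     (Node Leaf T) (els (unary (iterations c p (els (hd_tree t))))))"

subsection \<open>Running time\<close>

lemma ptime_meets [ptime_intros]:
  assumes "ptime f" "ptime (\<lambda>t. tree_of_list (g t))"
  shows "ptime (\<lambda>t. tree_of_bool (meets (f t) (g t)))"
proof -
  note [ptime_intros] = assms[THEN ptime_comp]
  show ?thesis unfolding meets_def by (intro ptime_intros)
qed

lemma ptime_restrict [ptime_intros]:
  assumes "ptime (\<lambda>t. tree_of_list (f t))" "ptime (\<lambda>t. tree_of_list (g t))"
  shows "ptime (\<lambda>t. tree_of_list (restrict (f t) (g t)))"
proof -
  note [ptime_intros] = assms[THEN ptime_comp]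
  show ?thesis unfolding restrict_def by (intro ptime_intros)
qed

lemma ptime_touching [ptime_intros]:
  assumes "ptime (\<lambda>t. tree_of_list (f t))" "ptime (\<lambda>t. tree_of_list (g t))"
  shows "ptime (\<lambda>t. tree_of_list (touching (f t) (g t)))"
proof -
  note [ptime_intros] = assms[THEN ptime_comp]
  show ?thesis unfolding touching_def by (intro ptime_intros)
qed

lemma ptime_blocking [ptime_intros]:
  assumes "ptime (\<lambda>t. tree_of_list (f t))" "ptime (\<lambda>t. tree_of_list (g t))"
    "ptime (\<lambda>t. tree_of_list (h t))"
  shows "ptime (\<lambda>t. tree_of_list (blocking (f t) (g t) (h t)))"
  unfolding blocking_def by (intro ptime_intros assms)

lemma ptime_greedy [ptime_intros]:
  assumes "ptime (\<lambda>t. tree_of_list (b t))" "ptime (\<lambda>t. tree_of_list (E t))"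
    "ptime (\<lambda>t. tree_of_list (M t))" "ptime (\<lambda>t. tree_of_list (S t))" "ptime (\<lambda>t. tree_of_list (W t))"
  shows "ptime (\<lambda>t. tree_of_list (greedy (b t) (E t) (M t) (S t) (W t)))"
proof -
  note [ptime_intros] = assms[THEN ptime_comp]
  show ?thesis
    unfolding greedy_def
  proof (rule ptime_foldl_list[where d = "[:1, 1:]"])
    show "size (tree_of_list (if P then x # s else s)) \<le> size (tree_of_list s) + poly [:1, 1:] (size t + size x)"
      for P s x and t :: tree by simp
  qed (intro ptime_intros)+
qed

lemma ptime_number [ptime_intros]:
  assumes "ptime (\<lambda>t. tree_of_list (b t))" "ptime (\<lambda>t. tree_of_list (M t))" "ptime k"
  shows "ptime (\<lambda>t. unary (number (b t) (M t) (k t)))"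
  unfolding number_def by (intro ptime_intros assms)

lemma ptime_choice [ptime_intros]:
  assumes "ptime (\<lambda>t. tree_of_list (b t))" "ptime (\<lambda>t. tree_of_list (E t))"
    "ptime (\<lambda>t. tree_of_list (M t))" "ptime v" "ptime k"
  shows "ptime (\<lambda>t. tree_of_list (choice (b t) (E t) (M t) (v t) (k t)))"
  unfolding choice_def by (intro ptime_intros assms)

lemma ptime_collapsible [ptime_intros]:
  assumes "ptime (\<lambda>t. tree_of_list (b t))" "ptime (\<lambda>t. tree_of_list (E t))"
    "ptime (\<lambda>t. tree_of_list (M t))" "ptime v" "ptime k"
  shows "ptime (\<lambda>t. tree_of_bool (collapsible G (b t) (E t) (M t) (v t) (k t)))"
  unfolding collapsible_def by (intro ptime_intros assms)

lemma ptime_scan [ptime_intros]: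
  assumes "ptime (\<lambda>t. tree_of_list (b t))" "ptime (\<lambda>t. tree_of_list (E t))"
    "ptime (\<lambda>t. tree_of_list (M t))" "ptime v" "ptime k"
  shows "ptime (\<lambda>t. scan G (b t) (E t) (M t) (v t) (k t))"
proof -
  note [ptime_intros] = assms[THEN ptime_comp]
  show ?thesis
    unfolding scan_def
    by (rule ptime_foldl[where d = 0]) (intro ptime_intros assms | simp add: size_hd_tl)+
qed

lemma ptime_reachable [ptime_intros]:
  assumes "ptime (\<lambda>t. tree_of_list (b t))" "ptime (\<lambda>t. tree_of_list (M t))" "ptime v" "ptime k"
  shows "ptime (\<lambda>t. tree_of_list (reachable (b t) (M t) (v t) (k t)))"
  unfolding reachable_def by (intro ptime_intros assms)

lemma ptime_extension [ptime_intros]: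
  assumes "ptime (\<lambda>t. tree_of_list (b t))" "ptime (\<lambda>t. tree_of_list (E t))"
    "ptime (\<lambda>t. tree_of_list (M t))" "ptime v" "ptime k"
  shows "ptime (\<lambda>t. tree_of_list (extension (b t) (E t) (M t) (v t) (k t)))"
  unfolding extension_def by (intro ptime_intros assms)

lemma ptime_collapse [ptime_intros]:
  assumes "ptime (\<lambda>t. tree_of_list (b t))" "ptime (\<lambda>t. tree_of_list (E t))"
    "ptime (\<lambda>t. tree_of_list (M t))" "ptime v" "ptime k"
  shows "ptime (\<lambda>t. collapse (b t) (E t) (M t) (v t) (k t))"
proof -
  note [ptime_intros] = assms[THEN ptime_comp]
  show ?thesis unfolding collapse_def by (intro ptime_intros)
qed

lemma ptime_extend [ptime_intros]:
  assumes "ptime (\<lambda>t. tree_of_list (a t))" "ptime (\<lambda>t. tree_of_list (b t))"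
    "ptime (\<lambda>t. tree_of_list (E t))" "ptime (\<lambda>t. tree_of_list (M t))" "ptime v" "ptime k"
  shows "ptime (\<lambda>t. extend D (a t) (b t) (E t) (M t) (v t) (k t))"
proof -
  note [ptime_intros] = assms[THEN ptime_comp]
  show ?thesis unfolding extend_def by (intro ptime_intros)
qed

lemma ptime_advance [ptime_intros]:
  assumes "ptime (\<lambda>t. tree_of_list (a t))" "ptime (\<lambda>t. tree_of_list (b t))"
    "ptime (\<lambda>t. tree_of_list (E t))" "ptime (\<lambda>t. tree_of_list (M t))" "ptime v" "ptime k"
  shows "ptime (\<lambda>t. advance G D (a t) (b t) (E t) (M t) (v t) (k t))"
  unfolding advance_def by (intro ptime_intros assms)

lemma ptime_uncovered [ptime_intros]:
  assumes "ptime (\<lambda>t. tree_of_list (a t))" "ptime (\<lambda>t. tree_of_list (M t))"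
  shows "ptime (\<lambda>t. tree_of_list (uncovered (a t) (M t)))"
proof -
  note [ptime_intros] = assms[THEN ptime_comp]
  show ?thesis unfolding uncovered_def by (intro ptime_intros)
qed

lemma ptime_is_Nil [ptime_intros]:
  assumes "ptime (\<lambda>t. tree_of_list (f t))"
  shows "ptime (\<lambda>t. tree_of_bool (f t = []))"
proof -
  have "ptime (\<lambda>t. tree_of_bool (tree_of_list (f t) = Leaf))" by (intro ptime_intros assms)
  moreover have "tree_of_list xs = Leaf \<longleftrightarrow> xs = []" for xs by (cases xs) auto
  ultimately show ?thesis by simp
qed

lemma ptime_step [ptime_intros]:
  assumes "ptime (\<lambda>t. tree_of_list (a t))" "ptime (\<lambda>t. tree_of_list (b t))"
    "ptime (\<lambda>t. tree_of_list (E t))" "ptime s"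
  shows "ptime (\<lambda>t. step G D (a t) (b t) (E t) (s t))"
  unfolding step_def by (intro ptime_intros assms)

section \<open>Growth of the state in one step\<close>

abbreviation lsize :: "tree list \<Rightarrow> nat" where
  "lsize xs \<equiv> size (tree_of_list xs)"

lemma lsize_append: "lsize (xs @ ys) = lsize xs + lsize ys"
  by (simp add: size_tree_of_list)

lemma lsize_filter: "lsize (filter P xs) \<le> lsize xs"
  by (induction xs) auto

lemma lsize_greedy: "lsize (greedy b E M S W) \<le> lsize E"
proof -
  have "lsize (foldl (\<lambda>X e. if P X e then e # X else X) X E) \<le> lsize X + lsize E" for P X
  proof (induction E arbitrary: X)
    case (Cons e E)
    show ?case using Cons[of "e # X"] Cons[of X] by simp
  qed simp
  from this[of _ "[]"] show ?thesis unfolding greedy_def by simp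
qed

lemma size_scan: "size (scan G b E M v k) \<le> size k"
proof -
  have "size (foldl (\<lambda>s x. if P s then s else tl_tree s) k xs) \<le> size k" for P and xs :: "tree list"
    by (induction xs arbitrary: k) (auto intro: order_trans size_hd_tl)
  then show ?thesis unfolding scan_def .
qed

text \<open>All new lists are selections from the matching, \<open>E\<close> or \<open>a\<close>,
  and \<open>scan\<close> only drops layers. The growth is additive in \<open>k\<close>, as bounded
  iteration demands.\<close>

lemma size_advance:
  "size (advance G D a b E M v k) \<le> lsize M + size k + lsize E + lsize a + 5"
proof -
  have "size (collapse b E M v (scan G b E M v k)) \<le> lsize M + lsize E + size k + 1"
    using lsize_filter[of _ M] lsize_greedy[of b E M] size_scan[of G b E M v k]
    unfolding collapse_def choice_def by (simp add: lsize_append add_mono)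
  moreover have "size (extend D a b E M v k) \<le> lsize M + size k + lsize E + lsize a + 5"
  proof -
    have "lsize (extension b E M v k) \<le> lsize E" unfolding extension_def by (rule lsize_greedy)
    moreover have "lsize (filter (\<lambda>x. x \<in> set (reachable b M v k)
        \<and> \<not> x \<in> set (cat (extension b E M v k))) a) \<le> lsize a" by (rule lsize_filter)
    ultimately show ?thesis unfolding extend_def by simp
  qed
  ultimately show ?thesis unfolding advance_def by simp
qed

lemma size_step: "size (step G D a b E s) \<le> size s + lsize E + lsize a + 5"
proof (cases "hd_tree s = Leaf")
  case True
  have "size (hd_tree (tl_tree s)) + size (tl_tree (tl_tree s)) \<le> size s"
    by (cases s; cases "tl_tree s") auto
  then show ?thesis
    using True size_advance[of G D a b E "els (hd_tree (tl_tree s))"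
        "hd_tree (tree_of_list (uncovered a (els (hd_tree (tl_tree s)))))" "tl_tree (tl_tree s)"]
    unfolding step_def by auto
qed (simp add: step_def)

lemma ptime_find_matching: "ptime (find_matching G D c p)"
proof -
  have "ptime (\<lambda>t. foldl
     (\<lambda>s x. step G D (els (hd_tree t)) (els (hd_tree (tl_tree t))) (els (tl_tree (tl_tree t))) s)
     (Node Leaf T) (els (unary (iterations c p (els (hd_tree t))))))"
  proof (rule ptime_foldl[where d = "[:5, 2:]"])
    show "ptime (\<lambda>t. unary (iterations c p (els (hd_tree t))))"
      unfolding iterations_def by (intro ptime_intros)
    show "size (step G D (els (hd_tree t)) (els (hd_tree (tl_tree t))) (els (tl_tree (tl_tree t))) s)
        \<le> size s + poly [:5, 2:] (size t + size x)" for t s x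
    proof -
      have "size (tl_tree (tl_tree t)) \<le> size t" "size (hd_tree t) \<le> size t"
        using size_hd_tl order_trans by blast+
      then show ?thesis
        using size_step[of G D "els (hd_tree t)" "els (hd_tree (tl_tree t))" "els (tl_tree (tl_tree t))" s]
        by simp
    qed
  qed (intro ptime_intros)+
  then show ?thesis unfolding find_matching_def[abs_def] by (intro ptime_intros)
qed


subsection \<open>Correctness\<close>

abbreviation verts :: "tree \<Rightarrow> tree set" where
  "verts e \<equiv> set (els e)"

abbreviation edge_sets :: "tree list \<Rightarrow> tree set set" where
  "edge_sets M \<equiv> verts ` set M"

definition stack :: "tree \<Rightarrow> tree set set list" where
  "stack k = map (\<lambda>X. edge_sets (els X)) (els k)"

lemma stack_simps [simp]: "stack Leaf = []" "stack (Node X k) = edge_sets (els X) # stack k"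
  by (simp_all add: stack_def)

lemma meets_iff: "meets e W \<longleftrightarrow> verts e \<inter> set W \<noteq> {}"
  unfolding meets_def by blast

lemma set_restrict [simp]: "set (restrict b W) = set b \<inter> set W"
  unfolding restrict_def by auto

lemma touching_sets: "edge_sets (touching M W) = {f \<in> edge_sets M. f \<inter> set W \<noteq> {}}"
  unfolding touching_def meets_iff by auto

lemma set_cat_stack: "edge_sets (cat (els k)) = \<Union>(set (stack k))"
  unfolding stack_def set_cat by auto

text \<open>Edges are trees here; the combinatorial statements are applied to their vertex sets.\<close>

locale tree_hypergraph =
  fixes r :: nat and a b E :: "tree list"
  assumes uniform_trees: "uniform_bipartite_hypergraph r (set a) (set b) (edge_sets E)"
    and r2': "r \<ge> 2"
    and distinct_a: "distinct a" and distinct_E: "distinct E" and inj_E: "inj_on verts (set E)"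
begin

sublocale H: bipartite_hypergraph r "set a" "set b" "edge_sets E"
  by unfold_locales (use uniform_trees r2' in auto)

section \<open>From lists of trees to sets of edges\<close>

lemma card_edge_sets: "distinct M \<Longrightarrow> set M \<subseteq> set E \<Longrightarrow> card (edge_sets M) = length M"
  using inj_E by (metis card_image distinct_card inj_on_subset)

lemma blocking_sets: "edge_sets (blocking b M X) = H.blockers (edge_sets M) (edge_sets X)"
  unfolding blocking_def touching_sets H.blockers_def set_restrict set_cat by (simp add: Int_assoc)

lemma number_eq:
  assumes "distinct M" "set M \<subseteq> set E"
  shows "number b M k = H.num (edge_sets M) (stack k)"
proof -
  have "distinct (blocking b M X)" "set (blocking b M X) \<subseteq> set E" for X
    using assms unfolding blocking_def touching_def by auto
  then show ?thesis
    unfolding number_def H.num_def set_cat_stack[symmetric] blocking_sets[symmetric]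
    by (simp add: card_edge_sets)
qed

lemma reachable_sets: "set (reachable b M v k) = H.reach (edge_sets M) v (stack k)"
  unfolding reachable_def H.reach_def set_cat_stack[symmetric] blocking_sets[symmetric]
  by (simp add: set_cat)

lemma greedy_correct:
  fixes S W :: "tree list"
  assumes "set M \<subseteq> set E"
  defines "X \<equiv> greedy b E M S W"
  shows "distinct X" "set X \<subseteq> set E" "H.greedy_choice (edge_sets M) (set S) (set W) (edge_sets X)"
proof -
  define Z where "Z X = set W \<union> \<Union>(edge_sets X) \<union>
    (set b \<inter> \<Union>{f \<in> edge_sets M. f \<inter> \<Union>(edge_sets X) \<noteq> {}})" for X
  define h where "h X e = (if verts e \<inter> set S \<noteq> {} \<and> verts e \<inter> Z X = {} then e # X else X)" for X e
  have "edge_sets (touching M (cat X)) = {f \<in> edge_sets M. f \<inter> \<Union>(edge_sets X) \<noteq> {}}" for X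
    unfolding touching_sets set_cat by simp
  then have "set (W @ cat X @ restrict b (cat (touching M (cat X)))) = Z X" for X
    unfolding Z_def set_append set_restrict set_cat by (simp add: Un_assoc)
  then have X: "X = foldl h [] E"
    unfolding X_def greedy_def meets_iff h_def[abs_def] by simp
  have "Z X \<subseteq> Z (e # X)" for X e
    unfolding Z_def by (intro Un_mono Int_mono Union_mono order_refl) auto
  then have mono: "Z X \<subseteq> Z (h X e)" for X e
    unfolding h_def by simp
  have inv: "set X \<subseteq> set E \<and> distinct X \<and> pairwise disjnt (edge_sets X) \<and>
      (\<forall>e\<in>edge_sets X. e \<inter> set S \<noteq> {} \<and> e \<inter> set W = {}) \<and>
      (\<forall>f\<in>edge_sets M. \<forall>e\<in>edge_sets X. \<forall>e'\<in>edge_sets X.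
        f \<inter> set b \<inter> e \<noteq> {} \<longrightarrow> f \<inter> set b \<inter> e' \<noteq> {} \<longrightarrow> e = e')"
    (is "?inv X") if "set F \<subseteq> set E" "X = foldl h [] F" for F X
    using that
  proof (induction F arbitrary: X rule: rev_induct)
    case (snoc e F)
    define Y where "Y = foldl h [] F"
    have Y: "?inv Y" by (rule snoc.IH) (use snoc.prems in \<open>auto simp: Y_def\<close>)
    have X: "X = h Y e" using snoc.prems by (simp add: Y_def)
    have e: "e \<in> set E" using snoc.prems by simp
    show ?case
    proof (cases "verts e \<inter> set S \<noteq> {} \<and> verts e \<inter> Z Y = {}")
      case True
      have dis: "verts e \<inter> d = {}" if "d \<in> edge_sets Y" for d
        using True that unfolding Z_def by blast
      have eY: "e \<notin> set Y" using dis[of "verts e"] True by blast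
      have pw: "pairwise disjnt (insert (verts e) (edge_sets Y))"
      proof -
        have "disjnt (verts e) d" "disjnt d (verts e)" if "d \<in> edge_sets Y" for d
          using dis[OF that] by (auto simp: disjnt_def)
        then show ?thesis using Y by (simp add: pairwise_insert)
      qed
      have W: "verts e \<inter> set W = {}" using True unfolding Z_def by blast
      have sep: False
        if "f \<in> edge_sets M" "d \<in> edge_sets Y" "f \<inter> set b \<inter> d \<noteq> {}" "f \<inter> set b \<inter> verts e \<noteq> {}" for f d
      proof -
        have "f \<inter> \<Union>(edge_sets Y) \<noteq> {}" using that by blast
        then have "set b \<inter> f \<subseteq> Z Y" using that(1) unfolding Z_def by blast
        then show False using True that(4) by blast
      qed
      have XY: "X = e # Y" using True X unfolding h_def by simp
      show ?thesis
      proof (intro conjI ballI impI)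
        fix f d d' assume *: "f \<in> edge_sets M" "d \<in> edge_sets X" "d' \<in> edge_sets X"
          "f \<inter> set b \<inter> d \<noteq> {}" "f \<inter> set b \<inter> d' \<noteq> {}"
        then consider "d = verts e" "d' = verts e" | "d = verts e" "d' \<in> edge_sets Y"
          | "d \<in> edge_sets Y" "d' = verts e" | "d \<in> edge_sets Y" "d' \<in> edge_sets Y"
          unfolding XY by auto
        then show "d = d'"
        proof cases
          case 4
          have "\<forall>f\<in>edge_sets M. \<forall>e\<in>edge_sets Y. \<forall>e'\<in>edge_sets Y.
              f \<inter> set b \<inter> e \<noteq> {} \<longrightarrow> f \<inter> set b \<inter> e' \<noteq> {} \<longrightarrow> e = e'"
            using Y by (elim conjE)
          from bspec[OF bspec[OF bspec[OF this *(1)] 4(1)] 4(2)] show ?thesis using *(4,5) by simp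
        qed (use sep * in auto)
      qed (use Y e True W eY pw XY in auto)
    next
      case False
      then have "X = Y" unfolding X h_def by (rule if_not_P)
      then show ?thesis using Y by simp
    qed
  qed simp
  have max: "Z (foldl h X0 F) \<inter> verts e \<noteq> {}"
    if "e \<in> set F" "verts e \<inter> set S \<noteq> {}" for e F X0
    using that(1)
  proof (induction F arbitrary: X0)
    case (Cons d F)
    have up: "Z X1 \<subseteq> Z (foldl h X1 F)" for X1 F
    proof (induction F rule: rev_induct)
      case (snoc x F)
      then show ?case using mono[of "foldl h X1 F" x] by simp
    qed simp
    show ?case
    proof (cases "e = d")
      case True
      \<comment> \<open>If \<open>e\<close> is selected, it meets \<open>Z\<close> in its own
        vertices: it is nonempty because it meets \<open>S\<close>.\<close>
      have "Z (h X0 e) \<inter> verts e \<noteq> {}"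
        using that(2) unfolding h_def by (auto simp: Z_def)
      then show ?thesis using up[of "h X0 e" F] True by auto
    next
      case False
      then show ?thesis using Cons by auto
    qed
  qed simp
  note I = inv[OF order_refl X]
  show "distinct X" "set X \<subseteq> set E" using I by auto
  have "\<forall>e\<in>edge_sets E. e \<inter> set S \<noteq> {} \<longrightarrow> e \<inter> Z X \<noteq> {}"
    using max[of _ E "[]"] unfolding X[symmetric] by (auto simp: Int_commute)
  then show "H.greedy_choice (edge_sets M) (set S) (set W) (edge_sets X)"
    using I unfolding H.greedy_choice_def Z_def by (simp add: image_mono)
qed

lemma choice_correct:
  assumes "set M \<subseteq> set E"
  shows "distinct (choice b E M v k)" "set (choice b E M v k) \<subseteq> set E"
    "H.greedy_choice (edge_sets M) (H.target (edge_sets M) v (stack k))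
      (H.forbidden (edge_sets M) (stack k)) (edge_sets (choice b E M v k))"
proof -
  have "set (if k = Leaf then [v] else cat (blocking b M (els (hd_tree k))))
      = H.target (edge_sets M) v (stack k)"
    by (cases k) (auto simp: set_cat simp flip: blocking_sets)
  moreover have "set (restrict b (cat M @ cat (cat (els k)))) = H.forbidden (edge_sets M) (stack k)"
    unfolding H.forbidden_def set_cat_stack[symmetric] by (simp add: set_cat)
  ultimately show "H.greedy_choice (edge_sets M) (H.target (edge_sets M) v (stack k))
      (H.forbidden (edge_sets M) (stack k)) (edge_sets (choice b E M v k))"
    using greedy_correct(3)[OF assms] unfolding choice_def by metis
qed (use greedy_correct[OF assms] in \<open>auto simp: choice_def\<close>)

lemma extension_correct:
  assumes "set M \<subseteq> set E"
  shows "distinct (extension b E M v k)" "set (extension b E M v k) \<subseteq> set E"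
    "H.greedy_choice (edge_sets M) (H.reach (edge_sets M) v (stack k))
      (H.used (edge_sets M) (stack k)) (edge_sets (extension b E M v k))"
proof -
  have "set (restrict b (cat (cat (els k)) @ cat (blocking b M (cat (els k)))))
      = H.used (edge_sets M) (stack k)"
    unfolding H.used_def set_cat_stack[symmetric] blocking_sets[symmetric] by (simp add: set_cat)
  then show "H.greedy_choice (edge_sets M) (H.reach (edge_sets M) v (stack k))
      (H.used (edge_sets M) (stack k)) (edge_sets (extension b E M v k))"
    using greedy_correct(3)[OF assms] unfolding extension_def reachable_sets[symmetric] by metis
qed (use greedy_correct[OF assms] in \<open>auto simp: extension_def\<close>)

text \<open>A collapsible part is a fixed point of the scan, so a scan that ends elsewhere has
  tested and passed every level.\<close>

lemma scan_correct:
  fixes G :: nat and v k :: tree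
  assumes "distinct M" "set M \<subseteq> set E"
  defines "j \<equiv> scan G b E M v k"
  shows "\<exists>Z. els k = Z @ els j" "\<not> collapsible G b E M v j \<Longrightarrow> H.stuck G (edge_sets M) v (stack k)"
proof -
  define h where "h s x = (if collapsible G b E M v s then s else tl_tree s)" for s and x :: tree
  have suffix: "\<exists>Z. els k = Z @ els (foldl h k xs)" for k xs
  proof (induction xs arbitrary: k)
    case (Cons x xs)
    have "\<exists>Z. els k = Z @ els (h k x)" unfolding h_def by (cases k) auto
    then show ?case using Cons[of "h k x"] by (auto intro: append_assoc[symmetric])
  qed simp
  have fix': "foldl h k xs = k" if "collapsible G b E M v k" for k xs
    using that by (induction xs) (auto simp: h_def)
  have root: "H.stuck G (edge_sets M) v []" if "\<not> collapsible G b E M v Leaf"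
  proof -
    have "number b M Leaf = 1"
      by (simp add: number_def blocking_def touching_def cat_def meets_def restrict_def)
    then have "G * length (choice b E M v Leaf) < 1"
      using that unfolding collapsible_def tl_tree.simps by linarith
    then show ?thesis
      using choice_correct[OF assms(2), of v Leaf] card_edge_sets by (auto intro!: exI)
  qed
  have "H.stuck G (edge_sets M) v (stack k)" if "\<not> collapsible G b E M v (foldl h k (els k))"
    using that
  proof (induction k)
    case Leaf
    then show ?case using root by simp
  next
    case (Node X k)
    have nc: "\<not> collapsible G b E M v (Node X k)"
      using Node.prems fix'[of "Node X k"] by metis
    then have "h (Node X k) X = k" unfolding h_def by simp
    then have "H.stuck G (edge_sets M) v (stack k)" using Node by simp
    moreover have "G * length (choice b E M v (Node X k)) < H.num (edge_sets M) (stack k)"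
      using nc number_eq[OF assms(1,2)] unfolding collapsible_def by simp
    ultimately show ?case
      using choice_correct[OF assms(2), of v "Node X k"] card_edge_sets by (auto intro!: exI)
  qed
  moreover have "j = foldl h k (els k)" unfolding j_def scan_def h_def[abs_def] ..
  ultimately show "\<exists>Z. els k = Z @ els j" "\<not> collapsible G b E M v j \<Longrightarrow> H.stuck G (edge_sets M) v (stack k)"
    using suffix by auto
qed


text \<open>A hitting set \<open>R\<close> is kept as a witness in place of \<open>tau\<close>, and
  the output consists of trees taken from the input, so that it can be decoded.\<close>

definition good :: "real \<Rightarrow> tree \<Rightarrow> bool" where
  "good \<epsilon> u \<longleftrightarrow>
     (\<exists>m. u = Node Leaf m \<and> distinct (els m) \<and> set (els m) \<subseteq> set E \<and>
        perfect_matching (set a) (edge_sets E) (edge_sets (els m))) \<or>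
     (\<exists>s. u = Node T s \<and> distinct (els s) \<and> set (els s) \<subseteq> set a \<and>
        (\<exists>R\<subseteq>set b. hits R (edges_at (edge_sets E) (set (els s))) \<and>
           real (card R) \<le> (2 * real r - 3 + \<epsilon>) * (real (card (set (els s))) - 1)))"

section \<open>The invariant and the decrease of the potential along a run\<close>

context
  fixes \<epsilon> :: real and G D p :: nat
  assumes eps: "\<epsilon> > 0" and G: "r * (4 * D ^ 3) \<le> G"
    and D: "2 * (real r ^ 2 + 4 * real r + \<epsilon>) \<le> real D * \<epsilon>"
    and p: "2 * real G * real r + 2 \<le> (1 + 1 / (2 * real D)) ^ p"
begin

definition bound :: real where
  "bound = H.base G * (real (length a) + 2) ^ p"

text \<open>The bound on the height has to be carried along: growth is available only when all
  levels are stuck, that is, when a layer is pushed, whereas a collapse merely shortens the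
  stack.\<close>

definition running :: "tree \<Rightarrow> tree \<Rightarrow> bool" where
  "running m k \<longleftrightarrow> distinct (els m) \<and> set (els m) \<subseteq> set E \<and> H.matching (edge_sets (els m)) \<and>
     (uncovered a (els m) \<noteq> [] \<longrightarrow>
        H.layers D (edge_sets (els m)) (hd (uncovered a (els m))) (stack k)) \<and>
     H.base G ^ length (stack k) \<le> bound"

lemma D1: "D \<ge> 1"
proof (rule ccontr)
  assume "\<not> D \<ge> 1"
  then have "D = 0" by simp
  then have "2 * (real r ^ 2 + 4 * real r + \<epsilon>) \<le> 0" using D by simp
  moreover have "0 < real r ^ 2 + 4 * real r + \<epsilon>" using eps by (intro add_nonneg_pos) auto
  ultimately show False by (simp add: mult_le_0_iff)
qed

lemma G1: "G \<ge> 1" and G2: "r * (4 * D ^ 2) \<le> G"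
proof -
  have "D ^ 2 \<le> D ^ 3" using D1 by (intro power_increasing) auto
  then show G2: "r * (4 * D ^ 2) \<le> G" using G by (meson mult_le_mono2 order_trans)
  have "1 * (4 * 1) \<le> r * (4 * D ^ 2)" using D1 r2' by (intro mult_le_mono) auto
  then show "G \<ge> 1" using G2 by linarith
qed

lemma base_le: "H.base G \<le> (1 + 1 / (2 * real D)) ^ p"
  unfolding H.base_def[OF G1] by (rule p)

lemma base1: "H.base G \<ge> 1"
  unfolding H.base_def[OF G1] by simp

lemma bound1: "bound \<ge> 1"
proof -
  have "1 * 1 \<le> H.base G * (real (length a) + 2) ^ p"
    by (intro mult_mono base1 one_le_power) (use base1 in auto)
  then show ?thesis unfolding bound_def by simp
qed

lemma decrease: "base' \<le> bound \<Longrightarrow> base' > 0 \<Longrightarrow>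
    1 / (2 * real G * bound) \<le> 1 / (2 * real G * base')"
  using G1 bound1 by (intro divide_left_mono mult_left_mono) auto

lemma perfect:
  assumes "running m k" "uncovered a (els m) = []"
  shows "good \<epsilon> (Node Leaf m)"
proof -
  let ?M = "edge_sets (els m)"
  have M: "H.matching ?M" "distinct (els m)" "set (els m) \<subseteq> set E"
    using assms unfolding running_def by auto
  have "\<exists>!e. e \<in> ?M \<and> x \<in> e" if "x \<in> set a" for x
  proof -
    have "x \<in> set (cat (els m))" using assms(2) that unfolding uncovered_def filter_empty_conv by blast
    then show ?thesis using H.matching_eq[OF M(1)] unfolding set_cat by blast
  qed
  then have "perfect_matching (set a) (edge_sets E) ?M"
    using M(1) unfolding perfect_matching_def H.matching_def by simp
  then show ?thesis using M unfolding good_def by blast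
qed

lemma extend_correct:
  assumes run: "running m k" and unc: "uncovered a (els m) \<noteq> []"
  defines "v \<equiv> hd (uncovered a (els m))"
  assumes stuck: "H.stuck G (edge_sets (els m)) v (stack k)"
  defines "s \<equiv> extend D a b E (els m) v k"
  shows "(\<exists>u. s = Node T u \<and> good \<epsilon> u) \<or>
    (\<exists>m' k'. s = Node Leaf (Node m' k') \<and> running m' k' \<and>
      H.potential G (edge_sets (els m')) (stack k')
        \<le> H.potential G (edge_sets (els m)) (stack k) - 1 / (2 * real G * bound))"
proof -
  let ?M = "edge_sets (els m)" and ?X = "extension b E (els m) v k"
  have M: "H.matching ?M" "distinct (els m)" "set (els m) \<subseteq> set E"
    and L: "H.layers D ?M v (stack k)"
    using run unc unfolding running_def v_def by auto
  have "v \<in> set (uncovered a (els m))" using unc unfolding v_def by simp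
  then have v: "v \<in> set a" "v \<notin> \<Union>?M" unfolding uncovered_def set_cat by auto
  note X = extension_correct[OF M(3), of v k]
  note num = number_eq[OF M(2,3), of k]
  note cX = card_edge_sets[OF X(1,2)]
  show ?thesis
  proof (cases "number b (els m) k \<le> D * length ?X")
    case True
    let ?k = "Node (tree_of_list ?X) k"
    have s: "s = Node Leaf (Node m ?k)" unfolding s_def extend_def using True by simp
    have L': "H.layers D ?M v (stack ?k)"
      using H.layers_push[OF L X(3)] True num cX by simp
    \<comment> \<open>By \<open>base_le\<close>, a level costs at most \<open>p\<close> factors of
      the growth rate, and all growth together is at most \<open>length a\<close>. The additional
      factor \<open>base\<close> in \<open>bound\<close> is for the layer being pushed.\<close>
    have "H.base G ^ length (stack k) \<le> ((1 + 1 / (2 * real D)) ^ p) ^ length (stack k)"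
      using base1 by (intro power_mono base_le) auto
    also have "\<dots> = ((1 + 1 / (2 * real D)) ^ length (stack k)) ^ p"
      by (simp add: mult.commute flip: power_mult)
    also have "\<dots> \<le> (real (length a) + 2) ^ p"
    proof (rule power_mono)
      have "(1 + 1 / (2 * real D)) ^ length (stack k) \<le> real (H.num ?M (stack k))"
        by (rule H.num_ge_power[OF M(1) G2 D1 L stuck])
      also have "\<dots> \<le> real (length a)"
        using H.num_le_card_A[OF M(1) v] card_length[of a] order_trans by fastforce
      finally show "(1 + 1 / (2 * real D)) ^ length (stack k) \<le> real (length a) + 2" by simp
    qed simp
    finally have "H.base G ^ length (stack ?k) \<le> bound"
      unfolding bound_def using base1 by simp
    then have "running m ?k" using L' M unfolding running_def v_def by simp
    moreover have "H.potential G ?M (stack ?k)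
        \<le> H.potential G ?M (stack k) - 1 / (2 * real G * H.base G ^ length (stack ?k))"
      using H.potential_push[OF G1 M(1) v, of D "edge_sets ?X" "stack k"] L' by simp
    moreover have "1 / (2 * real G * bound) \<le> 1 / (2 * real G * H.base G ^ length (stack ?k))"
      using \<open>H.base G ^ length (stack ?k) \<le> bound\<close> base1 by (intro decrease) auto
    ultimately show ?thesis unfolding s by force
  next
    case False
    define S where "S = filter (\<lambda>x. x \<in> set (reachable b (els m) v k) \<and> \<not> x \<in> set (cat ?X)) a"
    have s: "s = Node T (Node T (tree_of_list S))"
      unfolding s_def extend_def S_def using False by simp
    have "set S = (set a \<inter> H.reach ?M v (stack k)) - \<Union>(edge_sets ?X)"
      unfolding S_def reachable_sets[symmetric] by (auto simp: set_cat)
    moreover have "D * card (edge_sets ?X) < H.num ?M (stack k)" using False num cX by simp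
    ultimately have "\<exists>R\<subseteq>set b. hits R (edges_at (edge_sets E) (set S)) \<and>
        real (card R) \<le> (2 * real r - 3 + \<epsilon>) * (real (card (set S)) - 1)"
      using H.certificate[OF M(1) v L stuck X(3) _ G eps D] by simp
    moreover have "distinct S" "set S \<subseteq> set a" using distinct_a unfolding S_def by auto
    ultimately have "good \<epsilon> (Node T (tree_of_list S))" unfolding good_def by auto
    then show ?thesis unfolding s by blast
  qed
qed

lemma collapse_correct:
  assumes run: "running m k" and unc: "uncovered a (els m) \<noteq> []"
  defines "v \<equiv> hd (uncovered a (els m))"
  assumes j: "els k = Z @ els j" and coll: "collapsible G b E (els m) v j"
  shows "\<exists>m'. collapse b E (els m) v j = Node m' j \<and> running m' j \<and>
      H.potential G (edge_sets (els m')) (stack j)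
        \<le> H.potential G (edge_sets (els m)) (stack k) - 1 / (2 * real G * bound)"
proof -
  let ?M = "edge_sets (els m)" and ?I = "choice b E (els m) v j"
  define M' where "M' = filter (\<lambda>f. \<not> meets f (cat ?I)) (els m) @ ?I"
  have M: "H.matching ?M" "distinct (els m)" "set (els m) \<subseteq> set E"
    and L: "H.layers D ?M v (stack k)" and len: "H.base G ^ length (stack k) \<le> bound"
    using run unc unfolding running_def v_def by auto
  have "v \<in> set (uncovered a (els m))" using unc unfolding v_def by simp
  then have v: "v \<in> set a" "v \<notin> \<Union>?M" unfolding uncovered_def set_cat by auto
  note I = choice_correct[OF M(3), of v j]
  have sets: "edge_sets M' = H.swap ?M (edge_sets ?I)"
    unfolding M'_def H.swap_def meets_iff set_cat by auto
  \<comment> \<open>A chosen edge is nonempty and meets the choice in itself, so the filter removes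
    any old copy of it and \<open>M'\<close> has no repetition.\<close>
  have "meets f (cat ?I)" if "f \<in> set ?I" for f
  proof -
    have "verts f \<in> edge_sets E" using that I(2) by blast
    then obtain w where "w \<in> verts f" using H.edge_B_nonempty by blast
    then show ?thesis using that unfolding meets_def set_cat by blast
  qed
  then have M': "distinct M'" "set M' \<subseteq> set E" "H.matching (edge_sets M')"
    using M I(1,2) H.matching_swap[OF M(1) I(3)] unfolding sets unfolding M'_def by auto
  have c: "H.num ?M (stack (tl_tree j)) \<le> G * card (edge_sets ?I)"
    using coll number_eq[OF M(2,3)] card_edge_sets[OF I(1,2)] unfolding collapsible_def by simp
  have k: "stack k = map (\<lambda>X. edge_sets (els X)) Z @ stack j"
    unfolding stack_def j by simp
  have "length (stack j) \<le> length (stack k)" unfolding k by simp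
  then have len': "H.base G ^ length (stack j) \<le> bound"
    using power_increasing[OF _ base1] len by (meson order_trans)
  have "(uncovered a M' \<noteq> [] \<longrightarrow> H.layers D (edge_sets M') (hd (uncovered a M')) (stack j)) \<and>
    H.potential G (edge_sets M') (stack j)
      \<le> H.potential G ?M (stack k) - 1 / (2 * real G * H.base G ^ length (stack j))"
  proof (cases j)
    case Leaf
    have "1 \<le> G * card (edge_sets ?I)" using c unfolding H.num_def by linarith
    then show ?thesis
      using H.swap_root[OF G1 M(1) v, of "edge_sets ?I" "stack k"] I(3) unfolding sets by (simp add: Leaf)
  next
    case (Node X j')
    have Lj: "H.layers D ?M v (edge_sets (els X) # stack j')"
      using H.layers_mono[of D ?M v _ "stack j"] L unfolding k by (simp add: Node)
    have Ij: "H.greedy_choice ?M (H.target ?M v (edge_sets (els X) # stack j'))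
        (H.forbidden ?M (edge_sets (els X) # stack j')) (edge_sets ?I)"
      using I(3) by (simp add: Node)
    note sw = H.swap_layers[OF M(1) Lj Ij]
    \<comment> \<open>Above the root an exchange covers the same vertices of \<open>A\<close>, so
      the head of \<open>uncovered\<close> remains the root of the stack.\<close>
    have "set a \<inter> set (cat M') = set a \<inter> set (cat (els m))"
      using sw(4) unfolding sets[symmetric] set_cat by simp
    then have "uncovered a M' = uncovered a (els m)"
      unfolding uncovered_def by (intro filter_cong) auto
    moreover have "H.num ?M (stack j') \<le> G * card (edge_sets ?I)" using c by (simp add: Node)
    ultimately show ?thesis
      using sw(1) H.potential_swap_layer[OF G1 M(1) Lj Ij, of "map (\<lambda>X. edge_sets (els X)) Z"]
      unfolding sets k v_def by (simp add: Node)
  qed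
  moreover have "1 / (2 * real G * bound) \<le> 1 / (2 * real G * H.base G ^ length (stack j))"
    using len' base1 by (intro decrease) auto
  moreover have "collapse b E (els m) v j = Node (tree_of_list M') j"
    unfolding collapse_def M'_def ..
  ultimately show ?thesis using M' len' unfolding running_def by force
qed

lemma step_correct:
  assumes "running m k"
  defines "s \<equiv> step G D a b E (Node Leaf (Node m k))"
  shows "(\<exists>u. s = Node T u \<and> good \<epsilon> u) \<or>
    (\<exists>m' k'. s = Node Leaf (Node m' k') \<and> running m' k' \<and>
      H.potential G (edge_sets (els m')) (stack k')
        \<le> H.potential G (edge_sets (els m)) (stack k) - 1 / (2 * real G * bound))"
proof (cases "uncovered a (els m) = []")
  case True
  then have "s = Node T (Node Leaf m)" unfolding s_def step_def by simp
  then show ?thesis using perfect[OF assms(1) True] by blast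
next
  case False
  define v where "v = hd (uncovered a (els m))"
  define j where "j = scan G b E (els m) v k"
  have "hd_tree (tree_of_list (uncovered a (els m))) = v"
    using False unfolding v_def by (cases "uncovered a (els m)") auto
  then have s: "s = advance G D a b E (els m) v k"
    using False unfolding s_def step_def by simp
  have M: "distinct (els m)" "set (els m) \<subseteq> set E" using assms(1) unfolding running_def by auto
  note sc = scan_correct[OF M, where G = G and v = v and k = k, folded j_def]
  show ?thesis
  proof (cases "collapsible G b E (els m) v j")
    case True
    obtain Z where "els k = Z @ els j" using sc(1) by blast
    from collapse_correct[OF assms(1) False this] True obtain m' where
      "collapse b E (els m) v j = Node m' j" "running m' j"
      "H.potential G (edge_sets (els m')) (stack j)
        \<le> H.potential G (edge_sets (els m)) (stack k) - 1 / (2 * real G * bound)"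
      unfolding v_def by blast
    moreover have "s = Node Leaf (collapse b E (els m) v j)"
      unfolding s advance_def using True by (simp add: j_def)
    ultimately show ?thesis by auto
  next
    case nc: False
    have "s = extend D a b E (els m) v k" unfolding s advance_def using nc by (simp add: j_def)
    then show ?thesis
      using extend_correct[OF assms(1) False] sc(2)[OF nc] unfolding v_def by simp
  qed
qed

lemma iterate_correct:
  fixes xs :: "tree list"
  defines "s \<equiv> foldl (\<lambda>s x. step G D a b E s) (Node Leaf T) xs"
  shows "(\<exists>u. s = Node T u \<and> good \<epsilon> u) \<or>
    (\<exists>m k. s = Node Leaf (Node m k) \<and> running m k \<and>
      H.potential G (edge_sets (els m)) (stack k)
        \<le> real (length a) + 1 - real (length xs) / (2 * real G * bound))"
  unfolding s_def
proof (induction xs rule: rev_induct)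
  case Nil
  have "running Leaf Leaf" using bound1 by (simp add: running_def H.matching_def)
  moreover have "H.potential G {} [] \<le> real (length a) + 1"
    using card_length[of a] G1 by (simp add: H.potential_def[OF G1] add_mono)
  ultimately show ?case by simp
next
  case (snoc x xs)
  let ?s = "foldl (\<lambda>s x. step G D a b E s) (Node Leaf T) xs"
  from snoc consider u where "?s = Node T u" "good \<epsilon> u"
    | m k where "?s = Node Leaf (Node m k)" "running m k"
      "H.potential G (edge_sets (els m)) (stack k)
        \<le> real (length a) + 1 - real (length xs) / (2 * real G * bound)" by blast
  then show ?case
  proof cases
    case 1
    then show ?thesis by (simp add: step_def)
  next
    case 2
    have "real (length (xs @ [x])) / (2 * real G * bound)
        = real (length xs) / (2 * real G * bound) + 1 / (2 * real G * bound)"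
      by (simp add: add_divide_distrib)
    then show ?thesis using step_correct[OF 2(2)] 2 by force
  qed
qed

text \<open>The potential starts at no more than \<open>length a + 1\<close> and loses
  \<open>1 / (2 G bound)\<close> per round; after \<open>2 G bound (length a + 2)\<close> rounds
  without output it would be negative.\<close>

lemma find_matching_correct:
  "good \<epsilon> (find_matching G D (2 * G * (2 * G * r + 2)) (p + 1)
    (Node (tree_of_list a) (Node (tree_of_list b) (tree_of_list E))))"
proof -
  define n where "n = iterations (2 * G * (2 * G * r + 2)) (p + 1) a"
  define s where "s = foldl (\<lambda>s x. step G D a b E s) (Node Leaf T) (replicate n Leaf)"
  have "real n = (2 * real G * bound) * (real (length a) + 2)"
    unfolding n_def iterations_def bound_def H.base_def[OF G1] by (simp add: algebra_simps)
  then have "real n / (2 * real G * bound) = real (length a) + 2"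
    using bound1 G1 by simp
  then have "real (length a) + 1 - real (length (replicate n Leaf)) / (2 * real G * bound) < 0"
    by simp
  then obtain u where "s = Node T u" "good \<epsilon> u"
    using iterate_correct[of "replicate n Leaf"] H.potential_nonneg[OF G1]
    unfolding s_def by (meson not_less order_trans)
  moreover have "find_matching G D (2 * G * (2 * G * r + 2)) (p + 1)
      (Node (tree_of_list a) (Node (tree_of_list b) (tree_of_list E))) = tl_tree s"
    unfolding find_matching_def s_def n_def unary_def by simp
  ultimately show ?thesis by simp
qed

end

end


subsection \<open>Decoding\<close>

lemma inj_tree_of_nat: "inj tree_of_nat"
  by (rule injI) (rule tree_of_nat_inj)

lemma encodes_vertices_iff:
  "encodes_vertices X t \<longleftrightarrow> distinct (els t) \<and> set (els t) = tree_of_nat ` X"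
proof
  assume "encodes_vertices X t"
  then obtain xs ts where xs: "distinct xs" "set xs = X" "list_all2 encodes_vertex xs ts"
    "t = tree_of_list ts" unfolding encodes_set_def by blast
  have "ts = map tree_of_nat xs"
    using xs(3) by (auto simp: list_all2_conv_all_nth encodes_vertex_def intro: nth_equalityI)
  with xs show "distinct (els t) \<and> set (els t) = tree_of_nat ` X"
    by (simp add: distinct_map inj_on_subset[OF inj_tree_of_nat])
next
  assume t: "distinct (els t) \<and> set (els t) = tree_of_nat ` X"
  then have "\<forall>y\<in>set (els t). \<exists>x. y = tree_of_nat x" by blast
  then obtain xs where xs: "els t = map tree_of_nat xs" by (meson ex_map_conv)
  have "tree_of_nat ` set xs = tree_of_nat ` X" using t xs by simp
  then have "set xs = X" using inj_image_eq_iff[OF inj_tree_of_nat] by blast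
  moreover have "distinct xs" using t xs by (simp add: distinct_map)
  moreover have "list_all2 encodes_vertex xs (els t)"
    unfolding xs by (simp add: list_all2_conv_all_nth encodes_vertex_def)
  ultimately show "encodes_vertices X t"
    unfolding encodes_set_def by (metis tree_of_list_els)
qed

lemma encodes_edgesD:
  assumes "encodes_edges E t"
  shows "distinct (els t)" "edge_sets (els t) = (`) tree_of_nat ` E" "inj_on verts (set (els t))"
proof -
  obtain es ts where es: "distinct es" "set es = E" "list_all2 encodes_vertices es ts"
    "t = tree_of_list ts" using assms unfolding encodes_set_def by blast
  have len: "length es = length ts" using es(3) by (rule list_all2_lengthD)
  have v: "verts (ts ! i) = tree_of_nat ` (es ! i)" if "i < length ts" for i
    using list_all2_nthD2[OF es(3) that] unfolding encodes_vertices_iff by simp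
  have inj: "i = j" if "i < length ts" "j < length ts" "verts (ts ! i) = verts (ts ! j)" for i j
    using that v inj_image_eq_iff[OF inj_tree_of_nat] nth_eq_iff_index_eq[OF es(1)] len by metis
  show "distinct (els t)" using inj es(4) by (auto simp: distinct_conv_nth)
  show "inj_on verts (set (els t))" using es(4)
    by (intro inj_onI) (metis els_tree_of_list in_set_conv_nth inj)
  have "map verts ts = map ((`) tree_of_nat) es"
    using v len by (auto intro: nth_equalityI)
  then have "edge_sets ts = (`) tree_of_nat ` set es" by (metis list.set_map)
  then show "edge_sets (els t) = (`) tree_of_nat ` E" using es by simp
qed

text \<open>The selected trees are literally elements of the input, so each can be decoded;
  \<open>verts\<close> is injective on the input, so the decoded edges are distinct.\<close>

lemma encodes_edges_sublist:
  assumes "encodes_edges E t" "distinct (els m)" "set (els m) \<subseteq> set (els t)"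
  obtains M where "encodes_edges M m" "edge_sets (els m) = (`) tree_of_nat ` M"
proof -
  note t = encodes_edgesD[OF assms(1)]
  obtain es ts where es: "set es = E" "list_all2 encodes_vertices es ts" "t = tree_of_list ts"
    using assms(1) unfolding encodes_set_def by blast
  have "\<exists>e. encodes_vertices e f" if "f \<in> set (els m)" for f
    using that assms(3) es(2,3) by (metis els_tree_of_list in_set_conv_nth list_all2_nthD2 subsetD)
  then obtain dec where dec: "\<And>f. f \<in> set (els m) \<Longrightarrow> encodes_vertices (dec f) f" by metis
  have v: "verts f = tree_of_nat ` dec f" if "f \<in> set (els m)" for f
    using dec[OF that] unfolding encodes_vertices_iff by simp
  have "inj_on dec (set (els m))"
    by (rule inj_onI) (metis v assms(3) inj_onD[OF t(3)] subsetD)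
  then have "distinct (map dec (els m))" using assms(2) by (simp add: distinct_map)
  moreover have "list_all2 encodes_vertices (map dec (els m)) (els m)"
    using dec by (simp add: list_all2_conv_all_nth)
  ultimately have "encodes_edges (dec ` set (els m)) m"
    unfolding encodes_set_def by (intro exI[of _ "map dec (els m)"] exI[of _ "els m"]) simp
  moreover have "edge_sets (els m) = (`) tree_of_nat ` (dec ` set (els m))"
    using v by (simp add: image_image)
  ultimately show ?thesis by (rule that)
qed

lemma uniform_image:
  assumes "inj f" "uniform_bipartite_hypergraph r A B E"
  shows "uniform_bipartite_hypergraph r (f ` A) (f ` B) ((`) f ` E)"
proof -
  have "card (f ` e \<inter> f ` C) = card (e \<inter> C)" for e C
    using assms(1) by (simp add: card_image inj_on_subset flip: image_Int)
  moreover have "f ` e \<subseteq> f ` A \<union> f ` B" if "e \<in> E" for e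
  proof -
    have "e \<subseteq> A \<union> B" using assms(2) that unfolding uniform_bipartite_hypergraph_def by simp
    then show ?thesis by blast
  qed
  ultimately show ?thesis
    using assms unfolding uniform_bipartite_hypergraph_def
    by (simp add: image_Int[symmetric])
qed

lemma perfect_matching_image:
  assumes "inj f" "perfect_matching (f ` A) ((`) f ` E) ((`) f ` M)"
  shows "perfect_matching A E M"
proof -
  have inj: "inj ((`) f)" using assms(1) by (simp add: inj_image_eq_iff inj_on_def)
  have "(`) f ` M \<subseteq> (`) f ` E" using assms(2) unfolding perfect_matching_def by simp
  then have "M \<subseteq> E" using inj_image_subset_iff[OF inj] by simp
  moreover have "pairwise disjnt M"
  proof (rule pairwiseI)
    fix d e assume *: "d \<in> M" "e \<in> M" "d \<noteq> e"
    then have "f ` d \<noteq> f ` e" using inj_eq[OF inj] by simp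
    moreover have "pairwise disjnt ((`) f ` M)" using assms(2) unfolding perfect_matching_def by simp
    ultimately have "disjnt (f ` d) (f ` e)" using * by (auto simp: pairwise_image pairwise_def)
    then show "disjnt d e" unfolding disjnt_def by blast
  qed
  moreover have "\<exists>!e. e \<in> M \<and> a \<in> e" if "a \<in> A" for a
  proof -
    have "f a \<in> f ` A" using that by blast
    then have "\<exists>!e. e \<in> (`) f ` M \<and> f a \<in> e"
      using assms(2) unfolding perfect_matching_def by (elim conjE) (rule bspec)
    then obtain e' where e': "e' \<in> (`) f ` M" "f a \<in> e'"
      "\<And>d. d \<in> (`) f ` M \<and> f a \<in> d \<Longrightarrow> d = e'" by (elim ex1E) metis
    then obtain e where e: "e \<in> M" "e' = f ` e" by blast
    show ?thesis
    proof (rule ex1I)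
      show "e \<in> M \<and> a \<in> e"
        using e e'(2) assms(1) by (simp add: inj_image_mem_iff)
      show "d = e" if "d \<in> M \<and> a \<in> d" for d
        using e'(3)[of "f ` d"] that inj_eq[OF inj, of d e] e(2) by simp
    qed
  qed
  ultimately show ?thesis unfolding perfect_matching_def by blast
qed

text \<open>\<open>R\<close> lies in the image of \<open>B\<close>, so its preimage has the same
  cardinality, and it hits the original edges.\<close>

lemma tau_image_le:
  assumes "inj f" "finite B" "R \<subseteq> f ` B" "hits R (edges_at ((`) f ` E) (f ` S))"
  shows "tau B (edges_at E S) \<le> card R"
proof -
  define Q where "Q = f -` R"
  have R: "R = f ` Q" using assms(3) unfolding Q_def by blast
  have Q: "Q \<subseteq> B" using assms(3) R inj_image_subset_iff[OF assms(1)] by simp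
  have "card (f ` e \<inter> f ` S) = card (e \<inter> S)" for e
    using assms(1) by (simp add: card_image inj_on_subset flip: image_Int)
  then have edge: "f ` e \<in> edges_at ((`) f ` E) (f ` S)" if "e \<in> edges_at E S" for e
    using that unfolding edges_at_def by simp
  have "hits Q (edges_at E S)"
    unfolding hits_def
  proof
    fix e assume "e \<in> edges_at E S"
    from edge[OF this] have "R \<inter> f ` e \<noteq> {}" using assms(4) unfolding hits_def by blast
    then show "Q \<inter> e \<noteq> {}" unfolding Q_def by blast
  qed
  then have "\<exists>R'. R' \<subseteq> B \<and> finite R' \<and> hits R' (edges_at E S) \<and> card R' = card R"
    using Q finite_subset[OF Q assms(2)] card_image[OF inj_on_subset[OF assms(1)], of Q] R by auto
  then show ?thesis unfolding tau_def by (rule Least_le)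
qed


theorem theorem5p4:
  fixes \<epsilon> :: real and r :: nat
  assumes "\<epsilon> > 0" and "r \<ge> 2"
  shows "\<exists>(p :: program) (q :: nat poly). \<forall>A B E t.
     uniform_bipartite_hypergraph r A B E \<and> encodes_hypergraph A B E t \<longrightarrow>
     (\<exists>u n. runs p t u n \<and> n \<le> poly q (size t) \<and>
        ((\<exists>M. outputs_matching u M \<and> perfect_matching A E M) \<or>
         (\<exists>S. outputs_vertex_set u S \<and> S \<subseteq> A \<and>
            real (tau B (edges_at E S)) \<le> (2 * real r - 3 + \<epsilon>) * (real (card S) - 1))))"
proof -
  \<comment> \<open>This is the threshold of \<open>certificate\<close>, a constant for fixed
    \<open>r\<close> and \<epsilon>.\<close>
  obtain D :: nat where "2 * (real r ^ 2 + 4 * real r + \<epsilon>) / \<epsilon> < real D"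
    using reals_Archimedean2 by blast
  then have D: "2 * (real r ^ 2 + 4 * real r + \<epsilon>) \<le> real D * \<epsilon>"
    using assms(1) by (simp add: field_simps)
  define G where "G = r * (4 * D ^ 3)"
  have "D \<noteq> 0"
  proof
    assume "D = 0"
    then have "2 * (real r ^ 2 + 4 * real r + \<epsilon>) \<le> 0" using D by simp
    moreover have "0 < real r ^ 2 + 4 * real r + \<epsilon>"
      using assms(1) by (intro add_nonneg_pos) auto
    ultimately show False by (simp add: mult_le_0_iff)
  qed
  then have "1 < 1 + 1 / (2 * real D)" by simp
  \<comment> \<open>A constant exponent that compares \<open>base\<close> with the growth rate of
    the stack; it turns weights exponentially small in the height into inverse polynomials.\<close>
  then obtain k where k: "2 * real G * real r + 2 < (1 + 1 / (2 * real D)) ^ k"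
    using real_arch_pow by blast
  define F where "F = find_matching G D (2 * G * (2 * G * r + 2)) (k + 1)"
  obtain p q where pq: "computes p 0 F q"
    using ptime_find_matching unfolding ptime_def F_def by blast
  have "\<exists>u n. runs p t u n \<and> n \<le> poly q (size t) \<and>
        ((\<exists>M. outputs_matching u M \<and> perfect_matching A E M) \<or>
         (\<exists>S. outputs_vertex_set u S \<and> S \<subseteq> A \<and>
            real (tau B (edges_at E S)) \<le> (2 * real r - 3 + \<epsilon>) * (real (card S) - 1)))"
    if H: "uniform_bipartite_hypergraph r A B E" and t: "encodes_hypergraph A B E t" for A B E t
  proof -
    obtain ta tb te where enc: "encodes_vertices A ta" "encodes_vertices B tb" "encodes_edges E te"
      and t: "t = Node ta (Node tb te)" using t unfolding encodes_hypergraph_def by blast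
    note a = enc(1)[unfolded encodes_vertices_iff] and b = enc(2)[unfolded encodes_vertices_iff]
    note e = encodes_edgesD[OF enc(3)]
    \<comment> \<open>The encodings themselves serve as vertices; \<open>tree_of_nat\<close> is
      injective, so this is an isomorphic copy of the hypergraph.\<close>
    interpret tree_hypergraph r "els ta" "els tb" "els te"
      by unfold_locales (use a b e assms(2) uniform_image[OF inj_tree_of_nat H] in simp_all)
    have "good \<epsilon> (F t)"
      unfolding F_def t using find_matching_correct[OF assms(1) _ D less_imp_le[OF k]] by (simp add: G_def)
    then have "(\<exists>M. outputs_matching (F t) M \<and> perfect_matching A E M) \<or>
         (\<exists>S. outputs_vertex_set (F t) S \<and> S \<subseteq> A \<and>
            real (tau B (edges_at E S)) \<le> (2 * real r - 3 + \<epsilon>) * (real (card S) - 1))"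
      unfolding good_def
    proof (elim disjE exE conjE)
      fix m assume m: "F t = Node Leaf m" "distinct (els m)" "set (els m) \<subseteq> set (els te)"
        "perfect_matching (set (els ta)) (edge_sets (els te)) (edge_sets (els m))"
      obtain M where M: "encodes_edges M m" "edge_sets (els m) = (`) tree_of_nat ` M"
        using encodes_edges_sublist[OF enc(3) m(2,3)] .
      have "perfect_matching A E M"
        by (rule perfect_matching_image[OF inj_tree_of_nat]) (use m(4) a e M in simp)
      then show ?thesis using M m(1) unfolding outputs_matching_def by blast
    next
      fix s R assume s: "F t = Node T s" "distinct (els s)" "set (els s) \<subseteq> set (els ta)"
        and R: "R \<subseteq> set (els tb)" "hits R (edges_at (edge_sets (els te)) (set (els s)))"
        "real (card R) \<le> (2 * real r - 3 + \<epsilon>) * (real (card (set (els s))) - 1)"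
      define S where "S = tree_of_nat -` set (els s)"
      have "set (els s) \<subseteq> range tree_of_nat" using s(3) a by auto
      then have S: "set (els s) = tree_of_nat ` S" unfolding S_def by auto
      have SA: "S \<subseteq> A" using s(3) a S inj_image_subset_iff[OF inj_tree_of_nat] by simp
      have out: "outputs_vertex_set (F t) S"
        using s(1,2) S unfolding outputs_vertex_set_def encodes_vertices_iff by (intro exI[of _ s] conjI)
      have tau: "tau B (edges_at E S) \<le> card R"
        by (rule tau_image_le[OF inj_tree_of_nat])
          (use R b e S H in \<open>simp_all add: uniform_bipartite_hypergraph_def\<close>)
      have cS: "card (set (els s)) = card S"
        unfolding S by (rule card_image) (rule inj_on_subset[OF inj_tree_of_nat subset_UNIV])
      have "real (tau B (edges_at E S)) \<le> (2 * real r - 3 + \<epsilon>) * (real (card S) - 1)"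
        using R(3) tau unfolding cS by (meson of_nat_le_iff order_trans)
      with SA out show ?thesis by (intro disjI2 exI[of _ S] conjI)
    qed
    moreover obtain n where "eval p [t] (p ! 0) (F t) n" "n \<le> poly q (size t)" "0 < length p"
      using pq unfolding computes_def evalb_def by blast
    ultimately show ?thesis unfolding runs_def by (intro exI[of _ "F t"] exI[of _ n] conjI)
  qed
  then show ?thesis by (intro exI[of _ p] exI[of _ q] allI impI) (elim conjE)
qed

end
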